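(* Let $p$ be a prime and let $\{X_{n,k}:n\in\mathbb{N},\ k=1,\ldots,K_n\}$ be a rowwise independent array of random elements in the $p$-adic solenoid $S_p$. Suppose that there exist an element $a=(a_0,a_1,\ldots)\in S_p$ and a nonnegative real number $b$ such that (i) $\exp\left\{\frac{i}{p^d}\sum_{k=1}^{K_n}\mathrm{E}\,\arg((X_{n,k})_0)\right\}\to a_d$ as $n\to\infty$ for all $d\in\mathbb{Z}_+$, (ii) $\sum_{k=1}^{K_n}\mathrm{Var}\,\arg((X_{n,k})_0)\to b$ as $n\to\infty$, (iii) $\sum_{k=1}^{K_n}\mathrm{P}\bigl(\exists\,j\le d:|\arg((X_{n,k})_j)|>\varepsilon\bigr)\to0$ as $n\to\infty$ for all $d\in\mathbb{Z}_+$, $\varepsilon>0$. Then the array $\{X_{n,k}\}$ is infinitesimal, and the distribution of $\sum_{k=1}^{K_n}X_{n,k}$ converges weakly to $\delta_a*\gamma_{\psi_b}$ as $n\to\infty$.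
   Context: $\mathbb{N}$ and $\mathbb{Z}_+$ are the sets of positive and of nonnegative integers. $\mathbb{T}=\{e^{ix}:-\pi\le x<\pi\}$ is the circle group under multiplication. $S_p=\{(y_0,y_1,\ldots)\in\mathbb{T}^\infty:y_j=y_{j+1}^p\text{ for all }j\in\mathbb{Z}_+\}$, a compact Abelian group under coordinatewise multiplication with the topology inherited from the product topology; its identity is $e=(1,1,\ldots)$. $\sum_{k=1}^{K_n}X_{n,k}$ denotes the group operation (coordinatewise product) applied to $X_{n,1},\ldots,X_{n,K_n}$, and $(X_{n,k})_j$ is the $j$-th coordinate. $\arg:\mathbb{T}\to[-\pi,\pi)$ is given by $\arg(e^{ix})=x$ for $-\pi\le x<\pi$. Rowwise independent: for each $n$, $X_{n,1},\ldots,X_{n,K_n}$ are independent. Infinitesimal: $\lim_{n\to\infty}\max_{1\le k\le K_n}\mathrm{P}(X_{n,k}\in S_p\setminus U)=0$ for every Borel set $U$ containing an open set that contains $e$. $\delta_a$ is the Dirac measure at $a$ and $*$ is convolution. The characters of $S_p$ are $\chi_{d,\ell}(y)=y_d^\ell$, $d\in\mathbb{Z}_+$, $\ell\in\mathbb{Z}$, and $\gamma_{\psi_b}$ is the (existing, unique) probability measure on $S_p$ with $\int_{S_p}y_d^\ell\,d\gamma_{\psi_b}(y)=\exp\{-b\ell^2/(2p^{2d})\}$ for all $d\in\mathbb{Z}_+$, $\ell\in\mathbb{Z}$. *)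

theory Defs
  imports "HOL-Probability.Probability" "HOL-Computational_Algebra.Primes"
begin

text \<open>
  The solenoid is a subset of \<^typ>\<open>nat \<Rightarrow> complex\<close>, whose type class topology is the product
  topology; topology and Borel sets of the solenoid are the ones induced from there.  The group
  operation is written out as the coordinatewise product, with identity \<^term>\<open>\<lambda>_::nat. 1 :: complex\<close>.
\<close>

definition solenoid :: "nat \<Rightarrow> (nat \<Rightarrow> complex) set" where
  "solenoid p = {y. (\<forall>j. y j \<in> sphere 0 1) \<and> (\<forall>j. y j = y (Suc j) ^ p)}"

definition solenoid_borel :: "nat \<Rightarrow> (nat \<Rightarrow> complex) measure" where
  "solenoid_borel p = restrict_space borel (solenoid p)"

text \<open>
  Takes values in the half-open interval from \<open>-pi\<close> (included) to \<open>pi\<close> (excluded); the library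
  function \<^const>\<open>Arg\<close> has the opposite convention at the point \<open>-1\<close>.  It is only meaningful on
  the unit circle.
\<close>

definition circle_arg :: "complex \<Rightarrow> real" where
  "circle_arg z = (THE x. - pi \<le> x \<and> x < pi \<and> exp (\<i> * of_real x) = z)"

lemma circle_arg_exp:
  assumes "- pi \<le> x" "x < pi"
  shows "circle_arg (exp (\<i> * of_real x)) = x"
  unfolding circle_arg_def
proof (rule the_equality)
  fix y :: real
  assume y: "- pi \<le> y \<and> y < pi \<and> exp (\<i> * of_real y) = exp (\<i> * of_real x)"
  have "\<bar>y - x\<bar> < 2 * pi"
    using y assms by linarith
  then have "\<bar>Im (\<i> * complex_of_real y) - Im (\<i> * complex_of_real x)\<bar> < 2 * pi"
    by simp
  then have "\<i> * complex_of_real y = \<i> * complex_of_real x"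
    using y by (blast intro: exp_complex_eqI)
  then show "y = x" by simp
qed (use assms in simp)

text \<open>
  Convolution with respect to the group operation of the solenoid (the library's \<open>convolution\<close>
  is restricted to additive type class structures).
\<close>

definition solenoid_convolution ::
    "nat \<Rightarrow> (nat \<Rightarrow> complex) measure \<Rightarrow> (nat \<Rightarrow> complex) measure \<Rightarrow> (nat \<Rightarrow> complex) measure" where
  "solenoid_convolution p \<mu> \<nu> =
     distr (\<mu> \<Otimes>\<^sub>M \<nu>) (solenoid_borel p) (\<lambda>(x, y). (\<lambda>j. x j * y j))"

text \<open>
  The symmetric Gauss measure with parameter \<open>b\<close>, given by its Fourier transform on the characters
  \<open>y \<mapsto> y d powi l\<close>.
\<close>

definition solenoid_gauss :: "nat \<Rightarrow> real \<Rightarrow> (nat \<Rightarrow> complex) measure" where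
  "solenoid_gauss p b =
     (THE \<gamma>. prob_space \<gamma> \<and> sets \<gamma> = sets (solenoid_borel p) \<and>
        (\<forall>(d::nat) (l::int). (\<integral>y. y d powi l \<partial>\<gamma>) =
            of_real (exp (- (b * (real_of_int l)\<^sup>2 / (2 * real p ^ (2 * d)))))))"

definition rowwise_independent_array ::
    "nat \<Rightarrow> (nat \<Rightarrow> 'a measure) \<Rightarrow> (nat \<Rightarrow> nat) \<Rightarrow> (nat \<Rightarrow> nat \<Rightarrow> 'a \<Rightarrow> nat \<Rightarrow> complex) \<Rightarrow> bool" where
  "rowwise_independent_array p M K X \<longleftrightarrow>
     (\<forall>n\<ge>1. (\<forall>k\<in>{1..K n}. X n k \<in> measurable (M n) (solenoid_borel p)) \<and>
            prob_space.indep_vars (M n) (\<lambda>_. solenoid_borel p) (X n) {1..K n})"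

definition infinitesimal_array ::
    "nat \<Rightarrow> (nat \<Rightarrow> 'a measure) \<Rightarrow> (nat \<Rightarrow> nat) \<Rightarrow> (nat \<Rightarrow> nat \<Rightarrow> 'a \<Rightarrow> nat \<Rightarrow> complex) \<Rightarrow> bool" where
  "infinitesimal_array p M K X \<longleftrightarrow>
     (\<forall>U\<in>sets (solenoid_borel p).
        (\<exists>V. openin (top_of_set (solenoid p)) V \<and> (\<lambda>_. 1) \<in> V \<and> V \<subseteq> U) \<longrightarrow>
        (\<lambda>n. MAX k\<in>{1..K n}. measure (M n) {\<omega> \<in> space (M n). X n k \<omega> \<in> solenoid p - U})
          \<longlonglongrightarrow> 0)"

text \<open>
  The library's \<open>weak_conv_m\<close> only covers measures on the real line.
\<close>

definition solenoid_weak_conv ::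
    "nat \<Rightarrow> (nat \<Rightarrow> (nat \<Rightarrow> complex) measure) \<Rightarrow> (nat \<Rightarrow> complex) measure \<Rightarrow> bool" where
  "solenoid_weak_conv p \<mu> \<nu> \<longleftrightarrow>
     (\<forall>f :: (nat \<Rightarrow> complex) \<Rightarrow> real.
        continuous_on (solenoid p) f \<and> bounded (f ` solenoid p) \<longrightarrow>
        (\<lambda>n. \<integral>y. f y \<partial>(\<mu> n)) \<longlonglongrightarrow> (\<integral>y. f y \<partial>\<nu>))"

end

theory Submission imports Defs begin

text \<open>
  By the Stone--Weierstrass theorem the characters \<open>y \<mapsto> y d powi l\<close> span a dense subspace of the
  continuous functions on the compact solenoid, so weak convergence follows from convergence of
  the Fourier coefficients.  By independence these are products of the numbers
  \<open>E (X n k d powi l)\<close>.  If the first \<open>d + 1\<close> coordinates of a point \<open>y\<close> of the solenoid are close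
  to \<open>1\<close>, then \<open>y d = exp (i arg (y 0) / p ^ d)\<close>; the exceptional events have total probability
  tending to \<open>0\<close>, so \<open>X n k d powi l\<close> may be replaced by \<open>exp (i t arg (X n k 0))\<close> with
  \<open>t = l / p ^ d\<close>.  The rest is the Lindeberg argument for the bounded real array
  \<open>arg (X n k 0)\<close>: the product of its characteristic functions at \<open>t\<close> is asymptotic to
  \<open>exp (i t (sum of the means)) * exp (- t^2 b / 2)\<close>, which converges to
  \<open>a d powi l * exp (- b l^2 / (2 p ^ (2 d)))\<close>.
\<close>

section \<open>The argument function on the unit circle\<close>

text \<open>Conjugation reflects the circle in the real axis and so turns the interval
  \<open>(-pi, pi]\<close> of \<open>Arg\<close> into \<open>[-pi, pi)\<close>. This makes
  \<open>- Arg (cnj z)\<close> the right witness, including at the point -1.\<close>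

lemma
  assumes "norm z = 1"
  shows exp_circle_arg: "exp (\<i> * of_real (circle_arg z)) = z"
    and circle_arg_ge: "- pi \<le> circle_arg z"
    and circle_arg_less: "circle_arg z < pi"
proof -
  define x where "x = - Arg (cnj z)"
  have "exp (\<i> * of_real (Arg (cnj z))) = cnj z"
    using assms complex_norm_eq_1_exp_eq[of "cnj z"] by simp
  then have "cnj (exp (\<i> * of_real (Arg (cnj z)))) = z"
    by simp
  then have x: "exp (\<i> * of_real x) = z"
    by (simp add: x_def exp_cnj)
  have "- pi \<le> x" "x < pi"
    using mpi_less_Arg[of "cnj z"] Arg_le_pi[of "cnj z"] by (auto simp: x_def)
  with x circle_arg_exp[OF this] show "exp (\<i> * of_real (circle_arg z)) = z"
    "- pi \<le> circle_arg z" "circle_arg z < pi"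
    by auto
qed

lemma abs_circle_arg_le: "norm z = 1 \<Longrightarrow> \<bar>circle_arg z\<bar> \<le> pi"
  using circle_arg_ge[of z] circle_arg_less[of z] by linarith

text \<open>A chord is no longer than its arc. This converts bounds on arguments into bounds on the
  distance to 1, as needed for neighbourhoods of the identity.\<close>

lemma norm_minus_one_le_circle_arg:
  assumes "norm z = 1"
  shows "norm (z - 1) \<le> \<bar>circle_arg z\<bar>"
proof -
  have "norm (z - 1) = 2 * \<bar>sin (circle_arg z / 2)\<bar>"
    using dist_exp_i_1[of "circle_arg z"] exp_circle_arg[OF assms] by simp
  also have "\<dots> \<le> \<bar>circle_arg z\<bar>"
    using abs_sin_x_le_abs_x[of "circle_arg z / 2"] by simp
  finally show ?thesis .
qed

text \<open>The bound on \<open>real m * \<bar>circle_arg z\<bar>\<close> rules out wrapping around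
  the circle, so the multiplied angle still lies in the range of \<open>circle_arg\<close>.\<close>

lemma circle_arg_power:
  assumes "norm z = 1" "real m * \<bar>circle_arg z\<bar> < pi"
  shows "circle_arg (z ^ m) = real m * circle_arg z"
proof -
  have "z ^ m = exp (\<i> * of_real (circle_arg z)) ^ m"
    using exp_circle_arg[OF assms(1)] by simp
  also have "\<dots> = exp (\<i> * of_real (real m * circle_arg z))"
    by (subst exp_of_nat_mult[symmetric]) (simp add: mult_ac)
  finally have "circle_arg (z ^ m) = circle_arg (exp (\<i> * of_real (real m * circle_arg z)))"
    by simp
  also have "\<bar>real m * circle_arg z\<bar> < pi"
    using assms(2) by (simp add: abs_mult)
  then have "circle_arg (exp (\<i> * of_real (real m * circle_arg z))) = real m * circle_arg z"
    by (intro circle_arg_exp) auto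
  finally show ?thesis .
qed

text \<open>An explicit formula from which measurability can be read off. The strict test
  \<open>Im z > 0\<close> puts -1 into the second branch, where the value is
  \<open>- pi\<close>.\<close>

lemma circle_arg_eq_arccos:
  assumes "norm z = 1"
  shows "circle_arg z = (if Im z > 0 then arccos (Re z) else - arccos (Re z))"
proof -
  let ?t = "circle_arg z"
  have z: "Re z = cos ?t" "Im z = sin ?t"
    using exp_circle_arg[OF assms] by (simp_all add: complex_eq_iff flip: cis_conv_exp)
  show ?thesis
  proof (cases "sin ?t > 0")
    case True
    then have "?t > 0"
      using circle_arg_ge[OF assms] sin_ge_zero[of "- ?t"] by (cases "?t > 0") auto
    then show ?thesis
      using True z circle_arg_less[OF assms] by (simp add: arccos_cos)
  next
    case False
    then have "?t \<le> 0"
      using circle_arg_less[OF assms] sin_gt_zero[of ?t] by force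
    then show ?thesis
      using False z circle_arg_ge[OF assms] arccos_cos[of "- ?t"] by simp
  qed
qed

lemma borel_measurable_circle_arg:
  assumes f: "f \<in> borel_measurable M" and norm: "\<And>x. x \<in> space M \<Longrightarrow> norm (f x) = 1"
  shows "(\<lambda>x. circle_arg (f x)) \<in> borel_measurable M"
proof -
  \<comment> \<open>Clamping to [-1, 1] extends \<open>arccos\<close> to a function continuous on
    the whole line; nothing changes on values of norm 1.\<close>
  define g where "g r = arccos (max (-1) (min 1 r))" for r :: real
  have [measurable]: "g \<in> borel_measurable borel"
    unfolding g_def by (intro borel_measurable_continuous_onI continuous_intros) auto
  note f[measurable]
  have "(\<lambda>x. if Im (f x) > 0 then g (Re (f x)) else - g (Re (f x))) \<in> borel_measurable M"
    by measurable
  moreover have "circle_arg (f x) = (if Im (f x) > 0 then g (Re (f x)) else - g (Re (f x)))"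
    if "x \<in> space M" for x
  proof -
    have "\<bar>Re (f x)\<bar> \<le> 1"
      using abs_Re_le_cmod[of "f x"] norm[OF that] by simp
    then have "g (Re (f x)) = arccos (Re (f x))"
      by (simp add: g_def abs_le_iff)
    then show ?thesis
      by (simp add: circle_arg_eq_arccos[OF norm[OF that]])
  qed
  ultimately show ?thesis
    by (subst measurable_cong[where g = "\<lambda>x. if Im (f x) > 0 then g (Re (f x)) else - g (Re (f x))"])
qed

section \<open>Coordinates of points of the solenoid\<close>

lemma norm_solenoid: "y \<in> solenoid p \<Longrightarrow> norm (y j) = 1"
  unfolding solenoid_def by (metis (no_types, lifting) dist_0_norm mem_Collect_eq mem_sphere)

lemma solenoid_eq_Suc_power: "y \<in> solenoid p \<Longrightarrow> y j = y (Suc j) ^ p"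
  unfolding solenoid_def by blast

lemma solenoidI: "(\<And>j. norm (y j) = 1) \<Longrightarrow> (\<And>j. y j = y (Suc j) ^ p) \<Longrightarrow> y \<in> solenoid p"
  unfolding solenoid_def mem_Collect_eq mem_sphere dist_0_norm by (intro conjI allI)

lemma solenoid_eq_power:
  assumes "y \<in> solenoid p"
  shows "y j = y (j + k) ^ (p ^ k)"
proof (induction k)
  case (Suc k)
  have "y j = y (j + k) ^ (p ^ k)"
    by (rule Suc)
  also have "y (j + k) = y (Suc (j + k)) ^ p"
    by (rule solenoid_eq_Suc_power[OF assms])
  also have "\<dots> ^ (p ^ k) = y (j + Suc k) ^ (p ^ Suc k)"
    by (metis add_Suc_right power_Suc power_mult)
  finally show ?case .
qed simp

text \<open>As long as the arguments stay below \<open>pi / p\<close>, taking \<open>p\<close>-th powers multiplies them by \<open>p\<close>.\<close>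

lemma solenoid_coord_eq_exp:
  assumes y: "y \<in> solenoid p" and p: "p > 0"
    and small: "\<And>j. j \<le> d \<Longrightarrow> real p * \<bar>circle_arg (y j)\<bar> < pi"
  shows "y d = exp (\<i> * of_real (circle_arg (y 0) / real p ^ d))"
proof -
  have "circle_arg (y 0) = real p ^ j * circle_arg (y j)" if "j \<le> d" for j
    using that
  proof (induction j)
    case (Suc j)
    have "circle_arg (y j) = circle_arg (y (Suc j) ^ p)"
      by (rule arg_cong[OF solenoid_eq_Suc_power[OF y]])
    also have "\<dots> = real p * circle_arg (y (Suc j))"
      using Suc.prems y by (intro circle_arg_power small norm_solenoid)
    finally have "circle_arg (y j) = real p * circle_arg (y (Suc j))" .
    moreover have "circle_arg (y 0) = real p ^ j * circle_arg (y j)"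
      using Suc by simp
    ultimately show ?case
      by (simp only: power_Suc mult_ac)
  qed simp
  from this[of d] have "circle_arg (y 0) / real p ^ d = circle_arg (y d)"
    using p by (simp only: order_refl) (simp add: field_simps)
  then show ?thesis
    using exp_circle_arg[OF norm_solenoid[OF y]] by simp
qed

section \<open>Fourier analysis on the solenoid\<close>

text \<open>The product of the circles is compact by Tychonoff's theorem, and each relation between
  neighbouring coordinates cuts out a closed set.\<close>

lemma compact_solenoid: "compact (solenoid p)"
proof -
  have "compactin (product_topology (\<lambda>_::nat. euclidean) UNIV) (PiE UNIV (\<lambda>_. sphere (0::complex) 1))"
    by (subst compactin_PiE) auto
  then have "compact (PiE UNIV (\<lambda>_::nat. sphere (0::complex) 1))"
    by (simp add: euclidean_product_topology)
  moreover have "closed {y :: nat \<Rightarrow> complex. y j = y (Suc j) ^ p}" for j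
    by (intro closed_Collect_eq continuous_intros continuous_on_product_coordinates)
  then have "closed (\<Inter>j. {y :: nat \<Rightarrow> complex. y j = y (Suc j) ^ p})"
    by blast
  ultimately have "compact (PiE UNIV (\<lambda>_. sphere 0 1) \<inter> (\<Inter>j. {y :: nat \<Rightarrow> complex. y j = y (Suc j) ^ p}))"
    by (rule compact_Int_closed)
  also have "\<dots> = solenoid p"
    unfolding solenoid_def PiE_UNIV_domain Pi_def by blast
  finally show ?thesis .
qed

lemma space_solenoid_borel [simp]: "space (solenoid_borel p) = solenoid p"
  by (simp add: solenoid_borel_def space_restrict_space)

lemma measurable_solenoid_coord [measurable]: "(\<lambda>y. y j) \<in> borel_measurable (solenoid_borel p)"
  unfolding solenoid_borel_def
  by (intro borel_measurable_continuous_on_restrict continuous_on_subset[OF continuous_on_product_coordinates]) auto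

text \<open>The Borel sets of a countable product of copies of the complex plane are generated by
  the coordinates, so measurability can be checked coordinatewise.\<close>

lemma measurable_solenoid_borelI:
  assumes "\<And>j. (\<lambda>x. f x j) \<in> borel_measurable M" "\<And>x. x \<in> space M \<Longrightarrow> f x \<in> solenoid p"
  shows "f \<in> measurable M (solenoid_borel p)"
  unfolding solenoid_borel_def
  by (intro measurable_restrict_space2 measurable_coordinatewise_then_product assms) (auto simp: assms)

lemma integrable_solenoid:
  fixes f :: "(nat \<Rightarrow> complex) \<Rightarrow> 'b::{banach, second_countable_topology}"
  assumes "prob_space \<mu>" and sets: "sets \<mu> = sets (solenoid_borel p)"
    and cont: "continuous_on (solenoid p) f"
  shows "integrable \<mu> f"
proof -
  interpret prob_space \<mu> by fact
  have [simp]: "space \<mu> = solenoid p"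
    using sets_eq_imp_space_eq[OF sets] by simp
  have "bounded (f ` solenoid p)"
    by (intro compact_imp_bounded compact_continuous_image cont compact_solenoid)
  then obtain B where B: "\<And>y. y \<in> solenoid p \<Longrightarrow> norm (f y) \<le> B"
    by (auto simp: bounded_iff)
  have "f \<in> borel_measurable \<mu>"
    using borel_measurable_continuous_on_restrict[OF cont]
    by (simp add: measurable_cong_sets[OF sets refl] flip: solenoid_borel_def)
  then show ?thesis
    using B by (intro integrable_const_bound[where B = B]) auto
qed

section \<open>Characters, trigonometric polynomials and their density\<close>

lemma solenoid_nonzero: "y \<in> solenoid p \<Longrightarrow> y j \<noteq> 0"
  using norm_solenoid[of y p j] by auto

lemma continuous_on_solenoid_powi: "continuous_on (solenoid p) (\<lambda>y. y d powi l)"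
  by (intro continuous_on_power_int continuous_on_subset[OF continuous_on_product_coordinates])
    (use solenoid_nonzero in blast)+

lemma measurable_solenoid_powi [measurable]:
  "(\<lambda>y. y d powi l) \<in> borel_measurable (solenoid_borel p)"
  unfolding solenoid_borel_def
  by (rule borel_measurable_continuous_on_restrict[OF continuous_on_solenoid_powi])

lemma norm_solenoid_powi: "y \<in> solenoid p \<Longrightarrow> norm (y d powi l) = 1"
  using norm_solenoid[of y p d] by (simp add: norm_power_int)

text \<open>Real parts of complex combinations of characters: real values fit the real form of the
  Stone--Weierstrass theorem. The equations are demanded on the solenoid only, because the
  identities between characters hold only there.\<close>

inductive solenoid_trig_poly :: "nat \<Rightarrow> ((nat \<Rightarrow> complex) \<Rightarrow> real) \<Rightarrow> bool" for p where
  monomial: "(\<And>y. y \<in> solenoid p \<Longrightarrow> f y = Re (c * y d powi l)) \<Longrightarrow> solenoid_trig_poly p f"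
| add: "solenoid_trig_poly p f \<Longrightarrow> solenoid_trig_poly p g \<Longrightarrow>
    (\<And>y. y \<in> solenoid p \<Longrightarrow> h y = f y + g y) \<Longrightarrow> solenoid_trig_poly p h"

text \<open>Both \<open>y d\<close> and \<open>y e\<close> are powers of the common root
  \<open>y (d + e)\<close>, so a product of two characters is again a character. This is addition of
  the fractions \<open>l / p ^ d\<close> and \<open>m / p ^ e\<close> over a common
  denominator.\<close>

lemma solenoid_powi_mult:
  assumes y: "y \<in> solenoid p"
  shows "y d powi l * y e powi m = y (d + e) powi (int p ^ e * l + int p ^ d * m)"
proof -
  have "y d = y (d + e) powi (int p ^ e)" "y e = y (d + e) powi (int p ^ d)"
    using solenoid_eq_power[OF y, of d e] solenoid_eq_power[OF y, of e d]
    by (simp_all add: add.commute power_int_of_nat flip: of_nat_power)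
  moreover have "y (d + e) \<noteq> 0"
    using norm_solenoid[OF y, of "d + e"] by auto
  ultimately show ?thesis
    by (simp add: power_int_add power_int_mult)
qed

lemma cnj_solenoid_powi: "y \<in> solenoid p \<Longrightarrow> cnj (y d powi l) = y d powi (- l)"
  using norm_solenoid[of y p d] complex_div_cnj[of 1 "y d"]
  by (simp add: power_int_minus divide_inverse flip: power_int_inverse)

lemma Re_mult_Re: "Re u * Re v = Re (u * v / 2) + Re (u * cnj v / 2)"
  by (simp flip: add_divide_distrib)

text \<open>The product-to-sum formula \<open>Re_mult_Re\<close> writes a product of two monomials
  as a sum of two, since products and conjugates of characters are characters. Induction on both
  factors does the rest.\<close>

lemma solenoid_trig_poly_mult:
  assumes "solenoid_trig_poly p f" "solenoid_trig_poly p g"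
  shows "solenoid_trig_poly p (\<lambda>y. f y * g y)"
  using assms
proof (induction f)
  case (monomial f c d l)
  note f = monomial(1)
  from monomial(2) show ?case
  proof (induction g)
    case (monomial g c' e m)
    define h where "h s m y = Re ((c * s / 2) * y (d + e) powi (int p ^ e * l + int p ^ d * m))"
      for s :: complex and m :: int and y :: "nat \<Rightarrow> complex"
    have eq: "f y * g y = h c' m y + h (cnj c') (- m) y" if y: "y \<in> solenoid p" for y
      unfolding f[OF y] monomial[OF y] Re_mult_Re h_def solenoid_powi_mult[OF y, symmetric]
      by (simp only: cnj_solenoid_powi[OF y] complex_cnj_mult mult_ac)
        (simp only: mult_ac times_divide_eq_left times_divide_eq_right)
    have trig: "solenoid_trig_poly p (h s m)" for s m
      by (rule solenoid_trig_poly.monomial) (rule h_def)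
    show ?case
      by (rule solenoid_trig_poly.add[OF trig trig eq])
  next
    case (add g g' h)
    show ?case
      by (rule solenoid_trig_poly.add[OF add.IH]) (simp add: add.hyps(3) distrib_left)
  qed
next
  case (add f f' h)
  show ?case
    by (rule solenoid_trig_poly.add[OF add.IH(1,2)[OF add.prems]]) (simp add: add.hyps(3) distrib_right)
qed

lemma continuous_on_solenoid_trig_poly:
  "solenoid_trig_poly p f \<Longrightarrow> continuous_on (solenoid p) f"
proof (induction rule: solenoid_trig_poly.induct)
  case (monomial f c d l)
  have "continuous_on (solenoid p) (\<lambda>y. Re (c * y d powi l))"
    by (intro continuous_intros continuous_on_solenoid_powi)
  then show ?case
    using monomial by (simp cong: continuous_on_cong)
next
  case (add f g h)
  have "continuous_on (solenoid p) (\<lambda>y. f y + g y)"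
    by (intro continuous_intros add.IH)
  then show ?case
    using add.hyps by (simp cong: continuous_on_cong)
qed

lemma solenoid_trig_poly_dense:
  fixes f :: "(nat \<Rightarrow> complex) \<Rightarrow> real"
  assumes "continuous_on (solenoid p) f" "e > 0"
  obtains g where "solenoid_trig_poly p g" "\<And>y. y \<in> solenoid p \<Longrightarrow> \<bar>f y - g y\<bar> < e"
proof -
  interpret function_ring_on "Collect (solenoid_trig_poly p)" "solenoid p"
  proof
    show "(\<lambda>_. c) \<in> Collect (solenoid_trig_poly p)" for c
      using solenoid_trig_poly.monomial[of p "\<lambda>_. c" "of_real c" 0 0] by simp
    show "\<exists>f\<in>Collect (solenoid_trig_poly p). f x \<noteq> f y" if neq: "x \<noteq> y" for x y :: "nat \<Rightarrow> complex"
    proof -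
      obtain d where "x d \<noteq> y d"
        using neq by (auto simp: fun_eq_iff)
      \<comment> \<open>Real parts alone might not separate the points; the factor
        \<open>\<i>\<close> gives access to the imaginary part as well.\<close>
      then have "Re (1 * x d) \<noteq> Re (1 * y d) \<or> Re (\<i> * x d) \<noteq> Re (\<i> * y d)"
        by (simp add: complex_eq_iff)
      then obtain c where "Re (c * x d) \<noteq> Re (c * y d)"
        by blast
      moreover have "solenoid_trig_poly p (\<lambda>y. Re (c * y d))"
        using solenoid_trig_poly.monomial[of p "\<lambda>y. Re (c * y d)" c d 1] by simp
      ultimately show ?thesis
        by (intro bexI[of _ "\<lambda>y. Re (c * y d)"]) auto
    qed
  qed (auto simp: compact_solenoid continuous_on_solenoid_trig_poly
      intro: solenoid_trig_poly.add solenoid_trig_poly_mult)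
  show ?thesis
    using Stone_Weierstrass_basic[OF assms] that by blast
qed

section \<open>Fourier coefficients, weak convergence and uniqueness\<close>

definition fourier_coeff :: "(nat \<Rightarrow> complex) measure \<Rightarrow> nat \<Rightarrow> int \<Rightarrow> complex" where
  "fourier_coeff \<mu> d l = (\<integral>y. y d powi l \<partial>\<mu>)"

lemma integral_solenoid_trig_poly_tendsto:
  assumes prob: "\<And>n. prob_space (\<mu> n)" "prob_space \<nu>"
    and sets: "\<And>n. sets (\<mu> n) = sets (solenoid_borel p)" "sets \<nu> = sets (solenoid_borel p)"
    and lim: "\<And>d l. (\<lambda>n. fourier_coeff (\<mu> n) d l) \<longlonglongrightarrow> fourier_coeff \<nu> d l"
    and "solenoid_trig_poly p f"
  shows "(\<lambda>n. \<integral>y. f y \<partial>\<mu> n) \<longlonglongrightarrow> (\<integral>y. f y \<partial>\<nu>)"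
  using \<open>solenoid_trig_poly p f\<close>
proof induction
  case (monomial f c d l)
  have "(\<integral>y. f y \<partial>M) = Re (c * fourier_coeff M d l)"
    if M: "prob_space M" "sets M = sets (solenoid_borel p)" for M
  proof -
    have "(\<integral>y. f y \<partial>M) = (\<integral>y. Re (c * y d powi l) \<partial>M)"
      using sets_eq_imp_space_eq[OF M(2)] by (intro Bochner_Integration.integral_cong monomial) auto
    also have "\<dots> = Re (c * fourier_coeff M d l)"
      unfolding fourier_coeff_def
      by (subst integral_Re) (auto intro!: integrable_solenoid[OF M] continuous_intros continuous_on_solenoid_powi)
    finally show ?thesis .
  qed
  then show ?case
    by (simp only: prob sets) (intro tendsto_intros lim)
next
  case (add f g h)
  have "(\<integral>y. h y \<partial>M) = (\<integral>y. f y \<partial>M) + (\<integral>y. g y \<partial>M)"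
    if M: "prob_space M" "sets M = sets (solenoid_borel p)" for M
  proof -
    have "(\<integral>y. h y \<partial>M) = (\<integral>y. f y + g y \<partial>M)"
      using sets_eq_imp_space_eq[OF M(2)] by (intro Bochner_Integration.integral_cong add) auto
    also have "\<dots> = (\<integral>y. f y \<partial>M) + (\<integral>y. g y \<partial>M)"
      using add.hyps
      by (intro Bochner_Integration.integral_add integrable_solenoid[OF M] continuous_on_solenoid_trig_poly)
    finally show ?thesis .
  qed
  then show ?case
    by (simp only: prob sets) (intro tendsto_intros add.IH)
qed

text \<open>Integrals of trigonometric polynomials converge by linearity. A uniform approximation
  within \<open>e / 3\<close> changes each integral by at most \<open>e / 3\<close>, because all the
  measures have mass 1.\<close>

lemma solenoid_weak_convI:
  assumes prob: "\<And>n. prob_space (\<mu> n)" "prob_space \<nu>"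
    and sets: "\<And>n. sets (\<mu> n) = sets (solenoid_borel p)" "sets \<nu> = sets (solenoid_borel p)"
    and lim: "\<And>d l. (\<lambda>n. fourier_coeff (\<mu> n) d l) \<longlonglongrightarrow> fourier_coeff \<nu> d l"
  shows "solenoid_weak_conv p \<mu> \<nu>"
  unfolding solenoid_weak_conv_def
proof (intro allI impI LIMSEQ_I)
  fix f :: "(nat \<Rightarrow> complex) \<Rightarrow> real" and e :: real
  assume f: "continuous_on (solenoid p) f \<and> bounded (f ` solenoid p)" and e: "e > 0"
  obtain g where g: "solenoid_trig_poly p g" "\<And>y. y \<in> solenoid p \<Longrightarrow> \<bar>f y - g y\<bar> < e / 3"
    using solenoid_trig_poly_dense[of p f "e / 3"] f e by auto
  have close: "\<bar>(\<integral>y. f y \<partial>M) - (\<integral>y. g y \<partial>M)\<bar> \<le> e / 3"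
    if M: "prob_space M" "sets M = sets (solenoid_borel p)" for M
  proof -
    interpret prob_space M by fact
    have int: "integrable M f" "integrable M g"
      using f g(1) by (simp_all add: integrable_solenoid[OF M] continuous_on_solenoid_trig_poly)
    have "\<bar>(\<integral>y. f y \<partial>M) - (\<integral>y. g y \<partial>M)\<bar> = \<bar>\<integral>y. f y - g y \<partial>M\<bar>"
      using int by simp
    also have "\<dots> \<le> (\<integral>y. \<bar>f y - g y\<bar> \<partial>M)"
      by simp
    also have "\<dots> \<le> (\<integral>y. e / 3 \<partial>M)"
      using int g(2) sets_eq_imp_space_eq[OF M(2)] by (intro integral_mono) (auto intro: less_imp_le)
    finally show ?thesis
      by (simp add: prob_space)
  qed
  have "(\<lambda>n. \<integral>y. g y \<partial>\<mu> n) \<longlonglongrightarrow> (\<integral>y. g y \<partial>\<nu>)"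
    by (rule integral_solenoid_trig_poly_tendsto[OF prob sets lim g(1)])
  then obtain N where N: "\<And>n. n \<ge> N \<Longrightarrow> norm ((\<integral>y. g y \<partial>\<mu> n) - (\<integral>y. g y \<partial>\<nu>)) < e / 3"
    using LIMSEQ_D[of _ _ "e / 3"] e by (metis divide_pos_pos zero_less_numeral)
  show "\<exists>N. \<forall>n\<ge>N. norm ((\<integral>y. f y \<partial>\<mu> n) - (\<integral>y. f y \<partial>\<nu>)) < e"
  proof (intro exI allI impI)
    fix n assume "n \<ge> N"
    from N[OF this] close[OF prob(1)[of n] sets(1)] close[OF prob(2) sets(2)]
    show "norm ((\<integral>y. f y \<partial>\<mu> n) - (\<integral>y. f y \<partial>\<nu>)) < e"
      unfolding real_norm_def abs_le_iff abs_less_iff by linarith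
  qed
qed

text \<open>The indicator of a nonempty closed set is a decreasing limit of continuous functions of
  the distance to it, so the two measures agree on closed sets, which form an intersection-stable
  generator.\<close>

lemma solenoid_measure_eqI_integral:
  fixes \<mu> \<nu> :: "(nat \<Rightarrow> complex) measure"
  assumes prob: "prob_space \<mu>" "prob_space \<nu>"
    and sets: "sets \<mu> = sets (solenoid_borel p)" "sets \<nu> = sets (solenoid_borel p)"
    and eq: "\<And>f :: (nat \<Rightarrow> complex) \<Rightarrow> real. continuous_on (solenoid p) f \<Longrightarrow> (\<integral>y. f y \<partial>\<mu>) = (\<integral>y. f y \<partial>\<nu>)"
  shows "\<mu> = \<nu>"
proof (rule measure_eqI)
  show "sets \<mu> = sets \<nu>"
    using sets by simp
  have space: "space \<mu> = solenoid p" "space \<nu> = solenoid p"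
    using sets[THEN sets_eq_imp_space_eq] by simp_all
  have borel: "(\<lambda>y. y) \<in> measurable M borel" if "sets M = sets (solenoid_borel p)" for M
    using that measurable_coordinatewise_then_product[of "\<lambda>y. y", OF measurable_solenoid_coord[of _ p]]
    by (simp add: measurable_cong_sets[OF that refl])
  \<comment> \<open>Pushing forward along the inclusion moves the comparison to the whole product
    space; the measurable sets of the solenoid are the traces of Borel sets there.\<close>
  have "distr \<mu> borel (\<lambda>y. y) = distr \<nu> borel (\<lambda>y. y)"
  proof (rule measure_eqI_generator_eq[where E = "Collect closed" and \<Omega> = UNIV and A = "\<lambda>_. UNIV"])
    show "Int_stable (Collect closed)"
      by (auto simp: Int_stable_def)
    fix F :: "(nat \<Rightarrow> complex) set" assume "F \<in> Collect closed"
    then have F: "closed F" by simp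
    define f where "f k y = max 0 (1 - real k * infdist y F)" for k y
    have cont: "continuous_on A (f k)" for k A
      unfolding f_def by (intro continuous_intros)
    have lim: "(\<lambda>k. \<integral>y. f k y \<partial>M) \<longlonglongrightarrow> measure M (F \<inter> solenoid p)"
      if "F \<noteq> {}" and M: "prob_space M" "sets M = sets (solenoid_borel p)" for M
    proof -
      interpret prob_space M by fact
      have [simp]: "space M = solenoid p"
        using sets_eq_imp_space_eq[OF M(2)] by simp
      have FS: "F \<inter> solenoid p \<in> sets M"
        using measurable_sets[OF borel[OF M(2)] borel_closed[OF F]] by simp
      have "(\<lambda>k. \<integral>y. f k y \<partial>M) \<longlonglongrightarrow> (\<integral>y. indicator (F \<inter> solenoid p) y \<partial>M)"
      proof (rule integral_dominated_convergence[where w = "\<lambda>_. 1"])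
        show "f k \<in> borel_measurable M" for k
          using integrable_solenoid[OF M cont] by blast
        show "AE y in M. (\<lambda>k. f k y) \<longlonglongrightarrow> indicator (F \<inter> solenoid p) y"
        proof (rule AE_I2)
          fix y assume "y \<in> space M"
          show "(\<lambda>k. f k y) \<longlonglongrightarrow> indicator (F \<inter> solenoid p) y"
          proof (cases "y \<in> F")
            case True
            then show ?thesis
              using \<open>y \<in> space M\<close> by (simp add: f_def)
          next
            case False
            then have "infdist y F > 0"
              using F \<open>F \<noteq> {}\<close> in_closed_iff_infdist_zero infdist_nonneg by (metis less_le)
            then obtain N :: nat where N: "1 < real N * infdist y F"
              using reals_Archimedean3 by blast
            have "f k y = 0" if "k \<ge> N" for k
            proof -
              have "real N * infdist y F \<le> real k * infdist y F"
                using that by (intro mult_right_mono) (auto simp: infdist_nonneg)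
              then show ?thesis
                using N by (simp add: f_def)
            qed
            then have "eventually (\<lambda>k. f k y = 0) sequentially"
              by (auto simp: eventually_sequentially)
            then show ?thesis
              using False by (simp add: tendsto_eventually)
          qed
        qed
        show "AE y in M. norm (f k y) \<le> 1" for k
          by (simp add: f_def infdist_nonneg)
      qed (use FS in auto)
      then show ?thesis
        using FS by simp
    qed
    \<comment> \<open>The empty set is treated apart, since \<open>infdist y {}\<close> is 0 by
      convention and the functions \<open>f k\<close> would then be constantly 1.\<close>
    have "measure \<mu> (F \<inter> solenoid p) = measure \<nu> (F \<inter> solenoid p)"
    proof (cases "F = {}")
      case False
      then show ?thesis
        using lim[OF False prob(1) sets(1)] lim[OF False prob(2) sets(2)] eq[OF cont]
          LIMSEQ_unique by force
    qed simp
    then show "emeasure (distr \<mu> borel (\<lambda>y. y)) F = emeasure (distr \<nu> borel (\<lambda>y. y)) F"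
      using F prob[THEN prob_space.finite_measure]
      by (simp add: emeasure_distr borel sets space finite_measure.emeasure_eq_measure)
  next
    show "emeasure (distr \<mu> borel (\<lambda>y. y)) UNIV \<noteq> \<infinity>"
      using prob_space.emeasure_space_1[OF prob(1)]
      by (simp add: emeasure_distr borel sets flip: space(1))
  qed (auto simp: borel_eq_closed)
  then have *: "emeasure \<mu> (B \<inter> solenoid p) = emeasure \<nu> (B \<inter> solenoid p)" if "B \<in> sets borel" for B
    using that emeasure_distr[OF borel[OF sets(1)] that] emeasure_distr[OF borel[OF sets(2)] that]
    by (simp add: space)
  fix A assume "A \<in> sets \<mu>"
  then obtain B where "B \<in> sets borel" "A = B \<inter> solenoid p"
    unfolding sets solenoid_borel_def sets_restrict_space by blast
  then show "emeasure \<mu> A = emeasure \<nu> A"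
    using * by simp
qed

text \<open>Equal coefficients make the constant sequence at \<open>\<mu>\<close> converge weakly to
  \<open>\<nu>\<close>; a constant sequence of integrals equals its limit.\<close>

lemma solenoid_measure_eqI:
  assumes prob: "prob_space \<mu>" "prob_space \<nu>"
    and sets: "sets \<mu> = sets (solenoid_borel p)" "sets \<nu> = sets (solenoid_borel p)"
    and eq: "\<And>d l. fourier_coeff \<mu> d l = fourier_coeff \<nu> d l"
  shows "\<mu> = \<nu>"
proof (rule solenoid_measure_eqI_integral[OF prob sets])
  fix f :: "(nat \<Rightarrow> complex) \<Rightarrow> real" assume f: "continuous_on (solenoid p) f"
  then have "bounded (f ` solenoid p)"
    by (intro compact_imp_bounded compact_continuous_image compact_solenoid)
  moreover have "solenoid_weak_conv p (\<lambda>_. \<mu>) \<nu>"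
    by (rule solenoid_weak_convI) (auto simp: assms)
  ultimately have "(\<lambda>n::nat. \<integral>y. f y \<partial>\<mu>) \<longlonglongrightarrow> (\<integral>y. f y \<partial>\<nu>)"
    using f unfolding solenoid_weak_conv_def by blast
  then show "(\<integral>y. f y \<partial>\<mu>) = (\<integral>y. f y \<partial>\<nu>)"
    by (simp add: LIMSEQ_const_iff)
qed

section \<open>The one-parameter subgroup of the solenoid and the Gauss measures on it\<close>

lemma iexp_solenoid:
  assumes "p > 0"
  shows "(\<lambda>d. iexp (x / real p ^ d)) \<in> solenoid p"
proof -
  have root: "iexp (x / real p ^ d) = iexp (x / real p ^ Suc d) ^ p" for d
    using assms by (subst exp_of_nat_mult[symmetric]) (simp add: field_simps)
  show ?thesis
    by (intro solenoidI norm_exp_i_times root)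
qed

text \<open>The Gauss measure is the law of \<open>d \<mapsto> exp (i G / p ^ d)\<close> for a centred Gaussian \<open>G\<close> of variance \<open>b\<close>.\<close>

lemma
  assumes p: "p > 0" and b: "b \<ge> 0"
  shows prob_space_solenoid_gauss: "prob_space (solenoid_gauss p b)"
    and sets_solenoid_gauss: "sets (solenoid_gauss p b) = sets (solenoid_borel p)"
    and fourier_coeff_solenoid_gauss: "fourier_coeff (solenoid_gauss p b) d l =
      of_real (exp (- (b * (real_of_int l)\<^sup>2 / (2 * real p ^ (2 * d)))))"
proof -
  let ?P = "\<lambda>\<gamma>. prob_space \<gamma> \<and> sets \<gamma> = sets (solenoid_borel p) \<and>
        (\<forall>(d::nat) (l::int). (\<integral>y. y d powi l \<partial>\<gamma>) =
            of_real (exp (- (b * (real_of_int l)\<^sup>2 / (2 * real p ^ (2 * d))))))"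
  interpret N: prob_space std_normal_distribution
    using prob_space_normal_density by auto
  define G where "G x d = iexp (sqrt b * x / real p ^ d)" for x d
  have G[measurable]: "G \<in> measurable std_normal_distribution (solenoid_borel p)"
    unfolding G_def by (intro measurable_solenoid_borelI iexp_solenoid[OF p]) measurable
  have "(\<integral>y. y d powi l \<partial>distr std_normal_distribution (solenoid_borel p) G) =
      of_real (exp (- (b * (real_of_int l)\<^sup>2 / (2 * real p ^ (2 * d)))))" for d l
  proof -
    \<comment> \<open>Composed with \<open>G\<close>, the character with indices \<open>d\<close>
      and \<open>l\<close> becomes \<open>iexp (t * x)\<close>, so its integral is a value of the
      normal characteristic function.\<close>
    define t where "t = real_of_int l * sqrt b / real p ^ d"
    have "(\<integral>y. y d powi l \<partial>distr std_normal_distribution (solenoid_borel p) G) =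
        (\<integral>x. G x d powi l \<partial>std_normal_distribution)"
      by (rule integral_distr[OF G measurable_solenoid_powi])
    also have "\<dots> = char std_normal_distribution t"
      unfolding char_def G_def t_def by (simp add: exp_power_int mult_ac)
    also have "\<dots> = of_real (exp (- (t\<^sup>2) / 2))"
      by (simp add: char_std_normal_distribution)
    also have "- (t\<^sup>2) / 2 = - (b * (real_of_int l)\<^sup>2 / (2 * real p ^ (2 * d)))"
      using b by (simp add: t_def power_mult_distrib power_divide power_mult[symmetric] mult_ac)
    finally show ?thesis .
  qed
  then have "?P (distr std_normal_distribution (solenoid_borel p) G)"
    using N.prob_space_distr[OF G] by simp
  \<comment> \<open>Together with the measure just constructed, uniqueness makes the definite
    description in \<open>solenoid_gauss\<close> denote.\<close>
  moreover have "\<gamma> = \<gamma>'" if "?P \<gamma>" "?P \<gamma>'" for \<gamma> \<gamma>'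
    using that by (intro solenoid_measure_eqI) (auto simp: fourier_coeff_def)
  ultimately have "?P (solenoid_gauss p b)"
    unfolding solenoid_gauss_def by (intro theI'[of ?P]) blast
  then show "prob_space (solenoid_gauss p b)" "sets (solenoid_gauss p b) = sets (solenoid_borel p)"
    "fourier_coeff (solenoid_gauss p b) d l =
      of_real (exp (- (b * (real_of_int l)\<^sup>2 / (2 * real p ^ (2 * d)))))"
    by (auto simp: fourier_coeff_def)
qed

section \<open>Characteristic functions of bounded real arrays\<close>

text \<open>The upper bound for \<open>exp (- x)\<close> follows from the quadratic lower bound for
  \<open>exp x\<close>, because \<open>1 + x + x^2 / 2\<close> and \<open>1 - x + x^2 / 2\<close>
  have a product of at least 1.\<close>

lemma abs_exp_minus_le_square:
  fixes x :: real
  assumes "x \<ge> 0"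
  shows "\<bar>1 - x - exp (- x)\<bar> \<le> x\<^sup>2 / 2"
proof -
  have "(1 + x + x\<^sup>2 / 2) * (1 - x + x\<^sup>2 / 2) = 1 + (x\<^sup>2)\<^sup>2 / 4"
    by (simp add: field_simps power2_eq_square)
  then have "1 \<le> (1 + x + x\<^sup>2 / 2) * (1 - x + x\<^sup>2 / 2)"
    by simp
  also have "\<dots> \<le> exp x * (1 - x + x\<^sup>2 / 2)"
  proof (intro mult_right_mono)
    show "1 + x + x\<^sup>2 / 2 \<le> exp x"
      by (rule exp_lower_Taylor_quadratic[OF assms])
    have "0 \<le> (1 - x)\<^sup>2 / 2 + 1 / 2"
      by simp
    then show "0 \<le> 1 - x + x\<^sup>2 / 2"
      by (simp add: power2_eq_square field_simps)
  qed
  finally have "exp (- x) \<le> 1 - x + x\<^sup>2 / 2"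
    by (simp add: exp_minus field_simps)
  moreover have "1 - x \<le> exp (- x)"
    using exp_ge_add_one_self[of "- x"] by simp
  ultimately show ?thesis
    by simp
qed

context prob_space
begin

text \<open>The Lindeberg estimate for one variable: both the characteristic function of the centred
  variable and the Gaussian factor are compared with \<open>1 - t^2 V / 2\<close>, where
  \<open>V\<close> is the variance. The bound is arranged for summation over a row: a small multiple
  of the variance, plus a constant times a tail probability.\<close>

lemma bounded_char_approx:
  fixes X :: "'a \<Rightarrow> real"
  assumes X[measurable]: "random_variable borel X"
    and C: "\<And>\<omega>. \<omega> \<in> space M \<Longrightarrow> \<bar>X \<omega>\<bar> \<le> C"
    and \<delta>: "\<bar>expectation X\<bar> \<le> \<delta>"
  shows "cmod ((\<integral>\<omega>. iexp (t * X \<omega>) \<partial>M) - iexp (t * expectation X) * of_real (exp (- (t\<^sup>2 * variance X / 2))))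
    \<le> (\<bar>t\<bar> ^ 3 * \<delta> + t ^ 4 * \<delta>\<^sup>2) * variance X
      + 2 * (\<bar>t\<bar> ^ 3 * C ^ 3 + t ^ 4 * C ^ 4) * prob {\<omega> \<in> space M. \<bar>X \<omega>\<bar> > \<delta>}"
proof -
  define m where "m = expectation X"
  define Y where [abs_def]: "Y \<omega> = X \<omega> - m" for \<omega>
  define V where "V = variance X"
  define A where "A = {\<omega> \<in> space M. \<bar>X \<omega>\<bar> > \<delta>}"
  have A[measurable]: "A \<in> events"
    unfolding A_def by measurable
  have Y[measurable]: "random_variable borel Y"
    unfolding Y_def by measurable
  have "C \<ge> 0"
    using C not_empty by (metis abs_ge_zero all_not_in_conv order_trans)
  have intX: "integrable M X"
    using C by (intro integrable_const_bound[where B = C]) auto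
  have "\<bar>m\<bar> \<le> expectation (\<lambda>\<omega>. \<bar>X \<omega>\<bar>)"
    unfolding m_def by (rule integral_abs_bound)
  also have "\<dots> \<le> expectation (\<lambda>_. C)"
    using C intX by (intro integral_mono) auto
  finally have m: "\<bar>m\<bar> \<le> C"
    by (simp add: prob_space)
  have Y_le: "\<bar>Y \<omega>\<bar> \<le> 2 * C" if "\<omega> \<in> space M" for \<omega>
    using C[OF that] m unfolding Y_def by linarith
  \<comment> \<open>Outside \<open>A\<close> both \<open>X\<close> and its mean are bounded by
    \<open>\<delta>\<close>, so centring costs only a factor 2.\<close>
  have Y_small: "\<bar>Y \<omega>\<bar> \<le> 2 * \<delta>" if "\<omega> \<in> space M - A" for \<omega>
    using that \<delta> unfolding Y_def A_def m_def by auto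
  have intY: "integrable M (\<lambda>\<omega>. \<bar>Y \<omega>\<bar> ^ k)" for k
  proof (rule integrable_const_bound[where B = "(2 * C) ^ k"])
    show "AE \<omega> in M. norm (\<bar>Y \<omega>\<bar> ^ k) \<le> (2 * C) ^ k"
    proof (rule AE_I2)
      fix \<omega> assume "\<omega> \<in> space M"
      then have "\<bar>Y \<omega>\<bar> ^ k \<le> (2 * C) ^ k"
        by (intro power_mono Y_le) auto
      then show "norm (\<bar>Y \<omega>\<bar> ^ k) \<le> (2 * C) ^ k"
        by simp
    qed
  qed measurable
  have V: "V = expectation (\<lambda>\<omega>. (Y \<omega>)\<^sup>2)"
    by (simp add: V_def Y_def m_def)
  have "V \<ge> 0"
    unfolding V by simp
  have \<delta>0: "\<delta> \<ge> 0"
    using \<delta> abs_ge_zero order_trans by blast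
  \<comment> \<open>Truncation: off \<open>A\<close>, \<open>j\<close> of the factors are replaced
    by \<open>2 * \<delta>\<close>; on \<open>A\<close>, all of them by the crude bound
    \<open>2 * C\<close>. The cases (1, 2) and (2, 0) of \<open>(j, k)\<close> bound the third
    moment and the variance.\<close>
  have moment: "expectation (\<lambda>\<omega>. \<bar>Y \<omega>\<bar> ^ (j + k)) \<le> (2 * \<delta>) ^ j * expectation (\<lambda>\<omega>. \<bar>Y \<omega>\<bar> ^ k) + (2 * C) ^ (j + k) * prob A"
    for j k
  proof -
    have "expectation (\<lambda>\<omega>. \<bar>Y \<omega>\<bar> ^ (j + k)) \<le>
        expectation (\<lambda>\<omega>. (2 * \<delta>) ^ j * \<bar>Y \<omega>\<bar> ^ k + (2 * C) ^ (j + k) * indicator A \<omega>)"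
    proof (rule integral_mono)
      fix \<omega> assume \<omega>: "\<omega> \<in> space M"
      show "\<bar>Y \<omega>\<bar> ^ (j + k) \<le> (2 * \<delta>) ^ j * \<bar>Y \<omega>\<bar> ^ k + (2 * C) ^ (j + k) * indicator A \<omega>"
      proof (cases "\<omega> \<in> A")
        case True
        then show ?thesis
          using power_mono[OF Y_le[OF \<omega>], of "j + k"] \<delta>0 by (simp add: add_increasing)
      next
        case False
        then have "\<bar>Y \<omega>\<bar> ^ j \<le> (2 * \<delta>) ^ j"
          using \<omega> by (intro power_mono Y_small) auto
        then have "\<bar>Y \<omega>\<bar> ^ j * \<bar>Y \<omega>\<bar> ^ k \<le> (2 * \<delta>) ^ j * \<bar>Y \<omega>\<bar> ^ k"
          by (rule mult_right_mono) simp
        then show ?thesis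
          using False by (simp add: power_add)
      qed
    qed (use intY in \<open>auto intro!: integrable_real_mult_indicator simp: integrable_real_indicator emeasure_eq_measure\<close>)
    also have "\<dots> = (2 * \<delta>) ^ j * expectation (\<lambda>\<omega>. \<bar>Y \<omega>\<bar> ^ k) + (2 * C) ^ (j + k) * prob A"
      using intY by (subst Bochner_Integration.integral_add)
        (auto intro!: integrable_real_mult_indicator simp: integrable_real_indicator emeasure_eq_measure)
    finally show ?thesis .
  qed
  have third: "expectation (\<lambda>\<omega>. \<bar>Y \<omega>\<bar> ^ 3) \<le> 2 * \<delta> * V + 8 * C ^ 3 * prob A"
    using moment[of 1 2] by (simp add: V power_mult_distrib eval_nat_numeral)
  have second: "V \<le> 4 * \<delta>\<^sup>2 + 4 * C\<^sup>2 * prob A"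
    using moment[of 2 0] by (simp add: V power_mult_distrib prob_space)
  have "V \<le> 4 * C\<^sup>2"
  proof -
    have "V \<le> expectation (\<lambda>_. (2 * C)\<^sup>2)"
      unfolding V using intY[of 2] power_mono[OF Y_le abs_ge_zero, of _ 2]
      by (intro integral_mono) auto
    then show ?thesis
      by (simp add: prob_space power_mult_distrib)
  qed
  \<comment> \<open>One factor \<open>V\<close> is estimated by \<open>second\<close>; the other is
    kept in the first summand and bounded by \<open>4 * C^2\<close> in the second.\<close>
  then have square: "V\<^sup>2 \<le> 4 * \<delta>\<^sup>2 * V + 16 * C ^ 4 * prob A"
  proof -
    have "V\<^sup>2 \<le> V * (4 * \<delta>\<^sup>2 + 4 * C\<^sup>2 * prob A)"
      unfolding power2_eq_square[of V] by (rule mult_left_mono[OF second \<open>V \<ge> 0\<close>])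
    also have "\<dots> = 4 * \<delta>\<^sup>2 * V + V * (4 * C\<^sup>2 * prob A)"
      by (simp add: algebra_simps)
    also have "V * (4 * C\<^sup>2 * prob A) \<le> (4 * C\<^sup>2) * (4 * C\<^sup>2 * prob A)"
      by (rule mult_right_mono[OF \<open>V \<le> 4 * C\<^sup>2\<close>]) simp
    finally show ?thesis
      by (simp add: power2_eq_square eval_nat_numeral mult_ac)
  qed
  define \<phi> where "\<phi> = (\<integral>\<omega>. iexp (t * Y \<omega>) \<partial>M)"
  have "\<phi> = char (distr M borel Y) t"
    unfolding \<phi>_def char_def by (subst integral_distr) auto
  moreover have "integrable M Y" "integrable M (\<lambda>\<omega>. (Y \<omega>)\<^sup>2)" "expectation Y = 0"
    using intY[of 2] intX by (auto simp: Y_def m_def prob_space)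
  moreover from this have "variance Y = V"
    by (simp add: V)
  ultimately have "cmod (\<phi> - (1 - t\<^sup>2 * V / 2)) \<le> t\<^sup>2 / 6 * expectation (\<lambda>\<omega>. min (6 * (Y \<omega>)\<^sup>2) (\<bar>t\<bar> * \<bar>Y \<omega>\<bar> ^ 3))"
    using char_approx3'[of Y V "distr M borel Y" t] by simp
  also have "\<dots> \<le> t\<^sup>2 / 6 * expectation (\<lambda>\<omega>. \<bar>t\<bar> * \<bar>Y \<omega>\<bar> ^ 3)"
  proof (intro mult_left_mono integral_mono)
    show "integrable M (\<lambda>\<omega>. min (6 * (Y \<omega>)\<^sup>2) (\<bar>t\<bar> * \<bar>Y \<omega>\<bar> ^ 3))"
      using intY[of 2] intY[of 3] by (intro integrable_min) auto
  qed (use intY in auto)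
  also have "\<dots> = \<bar>t\<bar> ^ 3 / 6 * expectation (\<lambda>\<omega>. \<bar>Y \<omega>\<bar> ^ 3)"
    by (simp add: eval_nat_numeral)
  also have "\<dots> \<le> \<bar>t\<bar> ^ 3 / 6 * (2 * \<delta> * V + 8 * C ^ 3 * prob A)"
    by (intro mult_left_mono third) simp
  also have "\<dots> \<le> \<bar>t\<bar> ^ 3 * \<delta> * V + 2 * \<bar>t\<bar> ^ 3 * C ^ 3 * prob A"
  proof -
    have "0 \<le> \<bar>t\<bar> ^ 3 * \<delta> * V" "0 \<le> \<bar>t\<bar> ^ 3 * C ^ 3 * prob A"
      using \<delta>0 \<open>V \<ge> 0\<close> \<open>C \<ge> 0\<close> by simp_all
    then show ?thesis
      by (simp add: algebra_simps)
  qed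
  finally have 1: "cmod (\<phi> - (1 - t\<^sup>2 * V / 2)) \<le> \<bar>t\<bar> ^ 3 * \<delta> * V + 2 * \<bar>t\<bar> ^ 3 * C ^ 3 * prob A" .
  have "cmod ((1 - t\<^sup>2 * V / 2) - of_real (exp (- (t\<^sup>2 * V / 2)))) = \<bar>1 - t\<^sup>2 * V / 2 - exp (- (t\<^sup>2 * V / 2))\<bar>"
    unfolding norm_of_real[symmetric, where 'a = complex] by simp
  also have "\<dots> \<le> (t\<^sup>2 * V / 2)\<^sup>2 / 2"
    using \<open>V \<ge> 0\<close> by (intro abs_exp_minus_le_square) simp
  also have "\<dots> = t ^ 4 / 8 * V\<^sup>2"
    by (simp add: power2_eq_square eval_nat_numeral)
  also have "\<dots> \<le> t ^ 4 / 8 * (4 * \<delta>\<^sup>2 * V + 16 * C ^ 4 * prob A)"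
    by (intro mult_left_mono square) simp
  also have "\<dots> \<le> t ^ 4 * \<delta>\<^sup>2 * V + 2 * t ^ 4 * C ^ 4 * prob A"
  proof -
    have "0 \<le> t ^ 4 * \<delta>\<^sup>2 * V"
      using \<delta>0 \<open>V \<ge> 0\<close> by simp
    then show ?thesis
      by (simp add: algebra_simps)
  qed
  finally have 2: "cmod ((1 - t\<^sup>2 * V / 2) - of_real (exp (- (t\<^sup>2 * V / 2)))) \<le>
    t ^ 4 * \<delta>\<^sup>2 * V + 2 * t ^ 4 * C ^ 4 * prob A" .
  have "(\<integral>\<omega>. iexp (t * X \<omega>) \<partial>M) = (\<integral>\<omega>. iexp (t * m) * iexp (t * Y \<omega>) \<partial>M)"
    by (simp add: Y_def algebra_simps flip: exp_add)
  also have "\<dots> = iexp (t * m) * \<phi>"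
    by (simp add: \<phi>_def)
  finally have "(\<integral>\<omega>. iexp (t * X \<omega>) \<partial>M) - iexp (t * m) * of_real (exp (- (t\<^sup>2 * V / 2)))
    = iexp (t * m) * (\<phi> - of_real (exp (- (t\<^sup>2 * V / 2))))"
    by (simp add: algebra_simps)
  then have "cmod ((\<integral>\<omega>. iexp (t * X \<omega>) \<partial>M) - iexp (t * m) * of_real (exp (- (t\<^sup>2 * V / 2))))
    = cmod (\<phi> - of_real (exp (- (t\<^sup>2 * V / 2))))"
    by (simp only: norm_mult norm_exp_i_times mult_1)
  also have "\<dots> \<le> cmod (\<phi> - (1 - t\<^sup>2 * V / 2)) + cmod ((1 - t\<^sup>2 * V / 2) - of_real (exp (- (t\<^sup>2 * V / 2))))"
    using norm_triangle_ineq[of "\<phi> - (1 - t\<^sup>2 * V / 2)" "(1 - t\<^sup>2 * V / 2) - of_real (exp (- (t\<^sup>2 * V / 2)))"] by simp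
  also have "\<dots> \<le> (\<bar>t\<bar> ^ 3 * \<delta> + t ^ 4 * \<delta>\<^sup>2) * V + 2 * (\<bar>t\<bar> ^ 3 * C ^ 3 + t ^ 4 * C ^ 4) * prob A"
    using 1 2 by (simp add: algebra_simps)
  finally show ?thesis
    by (simp only: m_def V_def A_def)
qed

text \<open>Supplies the smallness of the means that \<open>bounded_char_approx\<close> requires:
  vanishing tails of uniformly bounded variables force vanishing means.\<close>

lemma abs_expectation_le_tail:
  fixes X :: "'a \<Rightarrow> real"
  assumes X[measurable]: "random_variable borel X"
    and C: "\<And>\<omega>. \<omega> \<in> space M \<Longrightarrow> \<bar>X \<omega>\<bar> \<le> C" and "\<delta> \<ge> 0"
  shows "\<bar>expectation X\<bar> \<le> \<delta> + C * prob {\<omega> \<in> space M. \<bar>X \<omega>\<bar> > \<delta>}"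
proof -
  let ?A = "{\<omega> \<in> space M. \<bar>X \<omega>\<bar> > \<delta>}"
  have int: "integrable M X"
    using C by (intro integrable_const_bound[where B = C]) auto
  have "\<bar>expectation X\<bar> \<le> expectation (\<lambda>\<omega>. \<bar>X \<omega>\<bar>)"
    by (rule integral_abs_bound)
  also have "\<dots> \<le> expectation (\<lambda>\<omega>. \<delta> + C * indicator ?A \<omega>)"
  proof (intro integral_mono)
    show "\<bar>X \<omega>\<bar> \<le> \<delta> + C * indicator ?A \<omega>" if "\<omega> \<in> space M" for \<omega>
      using C[OF that] \<open>\<delta> \<ge> 0\<close> that by (simp add: indicator_def)
  qed (use int in \<open>auto simp: emeasure_eq_measure\<close>)
  also have "\<dots> = \<delta> + C * prob ?A"
    by (simp add: prob_space emeasure_eq_measure)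
  finally show ?thesis .
qed

end

text \<open>The centring factors stay in the statement because the sums of the means need not converge.\<close>

lemma prod_char_bounded_array_tendsto:
  fixes X :: "nat \<Rightarrow> 'i \<Rightarrow> 'a \<Rightarrow> real" and b :: real
  assumes prob: "\<And>n. prob_space (M n)"
    and meas: "\<And>n k. k \<in> I n \<Longrightarrow> X n k \<in> borel_measurable (M n)"
    and C: "\<And>n k \<omega>. k \<in> I n \<Longrightarrow> \<omega> \<in> space (M n) \<Longrightarrow> \<bar>X n k \<omega>\<bar> \<le> C"
    and fin: "\<And>n. finite (I n)"
    and var: "(\<lambda>n. \<Sum>k\<in>I n. prob_space.variance (M n) (X n k)) \<longlonglongrightarrow> b"
    and tail: "\<And>\<epsilon>. \<epsilon> > 0 \<Longrightarrow> (\<lambda>n. \<Sum>k\<in>I n. measure (M n) {\<omega> \<in> space (M n). \<bar>X n k \<omega>\<bar> > \<epsilon>}) \<longlonglongrightarrow> 0"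
  shows "(\<lambda>n. (\<Prod>k\<in>I n. \<integral>\<omega>. iexp (t * X n k \<omega>) \<partial>M n)
      - iexp (t * (\<Sum>k\<in>I n. prob_space.expectation (M n) (X n k))) * exp (- (t\<^sup>2 * b / 2))) \<longlonglongrightarrow> 0"
proof -
  define m where "m n k = prob_space.expectation (M n) (X n k)" for n k
  define V where "V n k = prob_space.variance (M n) (X n k)" for n k
  define P where "P n \<delta> k = measure (M n) {\<omega> \<in> space (M n). \<bar>X n k \<omega>\<bar> > \<delta>}" for n \<delta> k
  define w where "w n k = iexp (t * m n k) * of_real (exp (- (t\<^sup>2 * V n k / 2)))" for n k
  define z where "z n k = (\<integral>\<omega>. iexp (t * X n k \<omega>) \<partial>M n)" for n k
  define D where "D = 2 * (\<bar>t\<bar> ^ 3 * C ^ 3 + t ^ 4 * C ^ 4)"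
  have V_nonneg: "V n k \<ge> 0" for n k
    unfolding V_def by simp
  have diff: "(\<lambda>n. (\<Prod>k\<in>I n. z n k) - (\<Prod>k\<in>I n. w n k)) \<longlonglongrightarrow> 0"
  proof (rule LIMSEQ_I)
    fix e :: real assume "e > 0"
    \<comment> \<open>The truncation level \<open>\<delta>\<close> is fixed before \<open>n\<close>.
      Since the row variances tend to \<open>b\<close>, their sum is eventually below
      \<open>b + 1\<close>, so the variance part of the error stays below
      \<open>e / 2\<close>.\<close>
    have "((\<lambda>\<delta>. (\<bar>t\<bar> ^ 3 * \<delta> + t ^ 4 * \<delta>\<^sup>2) * (b + 1)) \<longlongrightarrow> (\<bar>t\<bar> ^ 3 * 0 + t ^ 4 * 0\<^sup>2) * (b + 1)) (at_right 0)"
      by (intro tendsto_intros)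
    then have "eventually (\<lambda>\<delta>. (\<bar>t\<bar> ^ 3 * \<delta> + t ^ 4 * \<delta>\<^sup>2) * (b + 1) < e / 2) (at_right 0)"
      using \<open>e > 0\<close> by (intro order_tendstoD(2)) auto
    then obtain \<delta> where \<delta>: "\<delta> > 0" "(\<bar>t\<bar> ^ 3 * \<delta> + t ^ 4 * \<delta>\<^sup>2) * (b + 1) < e / 2"
      using eventually_happens'[OF trivial_limit_at_right_real eventually_conj[OF eventually_at_right_less[of 0]]]
      by blast
    have "eventually (\<lambda>n. (\<Sum>k\<in>I n. V n k) < b + 1) sequentially"
      using order_tendstoD(2)[OF var, of "b + 1"] by (simp add: V_def)
    moreover have "eventually (\<lambda>n. D * (\<Sum>k\<in>I n. P n \<delta> k) < e / 2) sequentially"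
      using tendsto_mult[OF tendsto_const tail[OF \<delta>(1)], of D] \<open>e > 0\<close>
      by (intro order_tendstoD(2)) (auto simp: P_def)
    \<comment> \<open>The tails at level \<open>\<delta> / 2\<close> contribute at most another
      \<open>\<delta> / 2\<close> to each mean, so all means of the row are at most
      \<open>\<delta>\<close>.\<close>
    moreover have "eventually (\<lambda>n. C * (\<Sum>k\<in>I n. P n (\<delta> / 2) k) < \<delta> / 2) sequentially"
      using tendsto_mult[OF tendsto_const tail[of "\<delta> / 2"], of C] \<delta>(1)
      by (intro order_tendstoD(2)) (auto simp: P_def)
    ultimately have "eventually (\<lambda>n. norm ((\<Prod>k\<in>I n. z n k) - (\<Prod>k\<in>I n. w n k) - 0) < e) sequentially"
    proof eventually_elim
      case (elim n)
      interpret prob_space "M n" by (rule prob)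
      have m: "\<bar>m n k\<bar> \<le> \<delta>" if k: "k \<in> I n" for k
      proof -
        have "C \<ge> 0"
          using C[OF k] not_empty by (metis abs_ge_zero all_not_in_conv order_trans)
        have "\<bar>m n k\<bar> \<le> \<delta> / 2 + C * P n (\<delta> / 2) k"
          unfolding m_def P_def using \<delta>(1) C[OF k] by (intro abs_expectation_le_tail meas[OF k]) auto
        also have "C * P n (\<delta> / 2) k \<le> C * (\<Sum>k\<in>I n. P n (\<delta> / 2) k)"
          using \<open>C \<ge> 0\<close> k fin by (intro mult_left_mono member_le_sum) (auto simp: P_def)
        finally show ?thesis
          using elim(3) by simp
      qed
      \<comment> \<open>Telescoping: all factors lie in the closed unit disc, so the errors of the
        single factors merely add up.\<close>
      have "norm ((\<Prod>k\<in>I n. z n k) - (\<Prod>k\<in>I n. w n k)) \<le> (\<Sum>k\<in>I n. norm (z n k - w n k))"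
      proof (rule norm_prod_diff)
        show "norm (z n k) \<le> 1" if "k \<in> I n" for k
        proof -
          have "norm (z n k) \<le> (\<integral>\<omega>. norm (iexp (t * X n k \<omega>)) \<partial>M n)"
            unfolding z_def by (rule integral_norm_bound)
          then show ?thesis
            by (simp add: prob_space)
        qed
        show "norm (w n k) \<le> 1" for k
          using V_nonneg[of n k] by (simp add: w_def norm_mult)
      qed
      also have "\<dots> \<le> (\<Sum>k\<in>I n. (\<bar>t\<bar> ^ 3 * \<delta> + t ^ 4 * \<delta>\<^sup>2) * V n k + D * P n \<delta> k)"
        unfolding z_def w_def m_def V_def D_def P_def
        by (intro sum_mono bounded_char_approx meas C) (use m in \<open>auto simp: m_def\<close>)
      also have "\<dots> = (\<bar>t\<bar> ^ 3 * \<delta> + t ^ 4 * \<delta>\<^sup>2) * (\<Sum>k\<in>I n. V n k) + D * (\<Sum>k\<in>I n. P n \<delta> k)"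
        by (simp add: sum.distrib sum_distrib_left)
      also have "\<dots> \<le> (\<bar>t\<bar> ^ 3 * \<delta> + t ^ 4 * \<delta>\<^sup>2) * (b + 1) + D * (\<Sum>k\<in>I n. P n \<delta> k)"
        using elim(1) \<delta>(1) by (intro add_right_mono mult_left_mono) auto
      also have "\<dots> < e"
        using elim(2) \<delta>(2) by simp
      finally show ?case
        by simp
    qed
    then show "\<exists>N. \<forall>n\<ge>N. norm ((\<Prod>k\<in>I n. z n k) - (\<Prod>k\<in>I n. w n k) - 0) < e"
      by (simp add: eventually_sequentially)
  qed
  have prod_w: "(\<Prod>k\<in>I n. w n k) = iexp (t * (\<Sum>k\<in>I n. m n k)) * of_real (exp (- (t\<^sup>2 * (\<Sum>k\<in>I n. V n k) / 2)))" for n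
  proof -
    have "(\<Prod>k\<in>I n. exp (- (t\<^sup>2 * V n k / 2))) = exp (- (t\<^sup>2 * (\<Sum>k\<in>I n. V n k) / 2))"
      using exp_sum[OF fin, of "\<lambda>k. - (t\<^sup>2 * V n k / 2)" n]
      by (simp add: sum_negf sum_distrib_left sum_divide_distrib)
    moreover have "(\<Prod>k\<in>I n. iexp (t * m n k)) = iexp (t * (\<Sum>k\<in>I n. m n k))"
      using exp_sum[OF fin, of "\<lambda>k. \<i> * of_real (t * m n k)" n]
      by (simp add: sum_distrib_left)
    ultimately show ?thesis
      by (simp add: w_def prod.distrib flip: of_real_prod)
  qed
  \<comment> \<open>The centring factor has norm 1, so it cannot spoil the convergence of the
    Gaussian factor, whatever the means do.\<close>
  have "(\<lambda>n. iexp (t * (\<Sum>k\<in>I n. m n k)) *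
      of_real (exp (- (t\<^sup>2 * (\<Sum>k\<in>I n. V n k) / 2)) - exp (- (t\<^sup>2 * b / 2)))) \<longlonglongrightarrow> 0"
  proof (rule tendsto_norm_zero_cancel)
    have "(\<lambda>n. exp (- (t\<^sup>2 * (\<Sum>k\<in>I n. V n k) / 2)) - exp (- (t\<^sup>2 * b / 2))) \<longlonglongrightarrow>
        exp (- (t\<^sup>2 * b / 2)) - exp (- (t\<^sup>2 * b / 2))"
      unfolding V_def by (intro tendsto_intros var) simp
    then show "(\<lambda>n. norm (iexp (t * (\<Sum>k\<in>I n. m n k)) *
      complex_of_real (exp (- (t\<^sup>2 * (\<Sum>k\<in>I n. V n k) / 2)) - exp (- (t\<^sup>2 * b / 2))))) \<longlonglongrightarrow> 0"
      unfolding norm_mult norm_exp_i_times norm_of_real mult_1 by (simp add: tendsto_rabs_zero)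
  qed
  from tendsto_add[OF diff this] show ?thesis
    unfolding prod_w by (simp add: z_def m_def right_diff_distrib)
qed

section \<open>Arrays in the solenoid\<close>

text \<open>A basic open set of the product topology restricts only finitely many coordinates. With
  \<open>d\<close> bounding their indices, small arguments up to \<open>d\<close> keep each
  restricted coordinate in a ball around 1.\<close>

lemma solenoid_nbhd_identity:
  assumes V: "openin (top_of_set (solenoid p)) V" "(\<lambda>_. 1) \<in> V"
  obtains d \<epsilon> where "\<epsilon> > 0"
    "\<And>y. y \<in> solenoid p \<Longrightarrow> (\<And>j. j \<le> d \<Longrightarrow> \<bar>circle_arg (y j)\<bar> \<le> \<epsilon>) \<Longrightarrow> y \<in> V"
proof -
  obtain T where T: "open T" "V = solenoid p \<inter> T"
    using V(1) by (auto simp: openin_open)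
  then have "openin (product_topology (\<lambda>_. euclidean) UNIV) T" "(\<lambda>_. 1) \<in> T"
    using V(2) by (auto simp: euclidean_product_topology)
  from product_topology_open_contains_basis[OF this] obtain W where
    W: "(\<lambda>_. 1) \<in> Pi\<^sub>E UNIV W" "\<And>j. open (W j)" "finite {j. W j \<noteq> UNIV}" "Pi\<^sub>E UNIV W \<subseteq> T"
    by auto
  have "1 \<in> W j" for j
    using W(1) by (auto simp: PiE_UNIV_domain)
  then have "\<exists>e>0. ball 1 e \<subseteq> W j" for j
    using W(2) openE by blast
  then obtain e where e: "\<And>j. e j > 0" "\<And>j. ball 1 (e j) \<subseteq> W j"
    by metis
  obtain d where d: "\<And>j. W j \<noteq> UNIV \<Longrightarrow> j \<le> d"
    using W(3) by (auto simp: finite_nat_set_iff_bounded_le)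
  \<comment> \<open>Halving turns the weak inequality for the arguments into membership in the open
    balls.\<close>
  define \<epsilon> where "\<epsilon> = Min (e ` {..d}) / 2"
  have Min: "Min (e ` {..d}) > 0"
    using e(1) by (subst Min_gr_iff) auto
  show ?thesis
  proof (rule that[of \<epsilon> d])
    show "\<epsilon> > 0"
      using Min by (simp add: \<epsilon>_def)
    fix y assume y: "y \<in> solenoid p" and small: "\<And>j. j \<le> d \<Longrightarrow> \<bar>circle_arg (y j)\<bar> \<le> \<epsilon>"
    have "y j \<in> W j" for j
    proof (cases "W j = UNIV")
      case False
      have "norm (y j - 1) \<le> \<epsilon>"
        using norm_minus_one_le_circle_arg[OF norm_solenoid[OF y, of j]] small[OF d[OF False]] by linarith
      also have "\<epsilon> < Min (e ` {..d})"
        using Min by (simp add: \<epsilon>_def)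
      also have "\<dots> \<le> e j"
        using d[OF False] by (intro Min_le) auto
      finally show ?thesis
        using e(2)[of j] by (auto simp: dist_norm norm_minus_commute)
    qed simp
    then show "y \<in> V"
      using y W(4) T(2) by (auto simp: PiE_UNIV_domain)
  qed
qed

section \<open>Measurability, products and convolution\<close>

lemma measurable_solenoid_circle_arg:
  assumes "X \<in> measurable M (solenoid_borel p)"
  shows "(\<lambda>\<omega>. circle_arg (X \<omega> j)) \<in> borel_measurable M"
  using measurable_space[OF assms] measurable_compose[OF assms measurable_solenoid_coord]
  by (intro borel_measurable_circle_arg norm_solenoid[of _ p]) auto

lemma sets_solenoid_circle_arg_large:
  assumes "X \<in> measurable M (solenoid_borel p)"
  shows "{\<omega> \<in> space M. \<exists>j\<le>d. \<bar>circle_arg (X \<omega> j)\<bar> > \<epsilon>} \<in> sets M"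
proof -
  note measurable_solenoid_circle_arg[OF assms, measurable]
  show ?thesis
    by measurable
qed

lemma solenoid_mult:
  assumes "x \<in> solenoid p" "y \<in> solenoid p"
  shows "(\<lambda>j. x j * y j) \<in> solenoid p"
proof (rule solenoidI)
  show "norm (x j * y j) = 1" for j
    using norm_solenoid[OF assms(1)] norm_solenoid[OF assms(2)] by (simp add: norm_mult)
  show "x j * y j = (x (Suc j) * y (Suc j)) ^ p" for j
    unfolding power_mult_distrib
    by (rule arg_cong2[OF solenoid_eq_Suc_power[OF assms(1)] solenoid_eq_Suc_power[OF assms(2)]])
qed

lemma solenoid_prod:
  assumes "\<And>k. k \<in> I \<Longrightarrow> x k \<in> solenoid p"
  shows "(\<lambda>j. \<Prod>k\<in>I. x k j) \<in> solenoid p"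
  using assms
proof (induction I rule: infinite_finite_induct)
  case (insert k I)
  then show ?case
    by (simp add: solenoid_mult)
qed (auto intro: solenoidI)

text \<open>Characters are multiplicative, so the integral over the product measure splits by
  Fubini's theorem.\<close>

lemma
  assumes prob: "prob_space \<mu>" "prob_space \<nu>"
    and sets: "sets \<mu> = sets (solenoid_borel p)" "sets \<nu> = sets (solenoid_borel p)"
  shows prob_space_solenoid_convolution: "prob_space (solenoid_convolution p \<mu> \<nu>)"
    and fourier_coeff_solenoid_convolution:
      "fourier_coeff (solenoid_convolution p \<mu> \<nu>) d l = fourier_coeff \<mu> d l * fourier_coeff \<nu> d l"
proof -
  interpret \<mu>: prob_space \<mu> by fact
  interpret \<nu>: prob_space \<nu> by fact
  interpret pair_prob_space \<mu> \<nu> ..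
  have space: "space \<mu> = solenoid p" "space \<nu> = solenoid p"
    using sets[THEN sets_eq_imp_space_eq] by simp_all
  have coord[measurable]: "(\<lambda>y. y j) \<in> borel_measurable \<mu>" "(\<lambda>y. y j) \<in> borel_measurable \<nu>" for j
    using measurable_solenoid_coord[of j p] by (simp_all add: measurable_cong_sets[OF sets(1) refl] measurable_cong_sets[OF sets(2) refl])
  have [measurable]: "(\<lambda>(x, y). (\<lambda>j. x j * y j)) \<in> measurable (\<mu> \<Otimes>\<^sub>M \<nu>) (solenoid_borel p)"
    by (intro measurable_solenoid_borelI) (auto simp: space_pair_measure space solenoid_mult split_beta)
  show "prob_space (solenoid_convolution p \<mu> \<nu>)"
    unfolding solenoid_convolution_def by (rule P.prob_space_distr) measurable
  have [measurable]: "(\<lambda>y. y d powi l) \<in> borel_measurable \<mu>" "(\<lambda>y. y d powi l) \<in> borel_measurable \<nu>"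
    using measurable_solenoid_powi[of d l p]
    by (simp_all add: measurable_cong_sets[OF sets(1) refl] measurable_cong_sets[OF sets(2) refl])
  have "fourier_coeff (solenoid_convolution p \<mu> \<nu>) d l =
      (\<integral>z. fst z d powi l * snd z d powi l \<partial>(\<mu> \<Otimes>\<^sub>M \<nu>))"
    unfolding fourier_coeff_def solenoid_convolution_def
    by (subst integral_distr[OF _ measurable_solenoid_powi]) (auto simp: split_beta power_int_mult_distrib)
  also have "\<dots> = (\<integral>x. \<integral>y. x d powi l * y d powi l \<partial>\<nu> \<partial>\<mu>)"
  proof -
    have "integrable (\<mu> \<Otimes>\<^sub>M \<nu>) (\<lambda>z. fst z d powi l * snd z d powi l)"
    proof (rule P.integrable_const_bound[where B = 1])
      show "AE z in \<mu> \<Otimes>\<^sub>M \<nu>. norm (fst z d powi l * snd z d powi l) \<le> 1"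
        by (rule AE_I2) (auto simp: space_pair_measure space norm_mult norm_solenoid_powi)
    qed measurable
    from integral_fst'[OF this] show ?thesis
      by simp
  qed
  also have "\<dots> = fourier_coeff \<mu> d l * fourier_coeff \<nu> d l"
    by (simp add: fourier_coeff_def)
  finally show "fourier_coeff (solenoid_convolution p \<mu> \<nu>) d l = fourier_coeff \<mu> d l * fourier_coeff \<nu> d l" .
qed

lemma sets_solenoid_convolution [simp]: "sets (solenoid_convolution p \<mu> \<nu>) = sets (solenoid_borel p)"
  by (simp add: solenoid_convolution_def)

lemma fourier_coeff_return: "a \<in> solenoid p \<Longrightarrow> fourier_coeff (return (solenoid_borel p) a) d l = a d powi l"
  unfolding fourier_coeff_def
  by (intro integral_return) simp_all

lemma prod_power_int: "(\<Prod>k\<in>I. f k) powi l = (\<Prod>k\<in>I. f k powi l)" for f :: "'i \<Rightarrow> 'b::field"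
  by (induction I rule: infinite_finite_induct) (simp_all add: power_int_mult_distrib)

section \<open>Fourier coefficients of row products and their comparison with real characteristic
  functions\<close>

context prob_space
begin

lemma fourier_coeff_distr_prod:
  assumes I: "finite I" and indep: "indep_vars (\<lambda>_. solenoid_borel p) X I"
  shows "fourier_coeff (distr M (solenoid_borel p) (\<lambda>\<omega> j. \<Prod>k\<in>I. X k \<omega> j)) d l =
    (\<Prod>k\<in>I. \<integral>\<omega>. X k \<omega> d powi l \<partial>M)"
proof -
  have X: "X k \<in> measurable M (solenoid_borel p)" if "k \<in> I" for k
    using indep that by (auto simp: indep_vars_def)
  have "(\<lambda>\<omega> j. \<Prod>k\<in>I. X k \<omega> j) \<in> measurable M (solenoid_borel p)"
    using X measurable_space[OF X]
    by (intro measurable_solenoid_borelI borel_measurable_prod measurable_compose[OF X measurable_solenoid_coord]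
        solenoid_prod) auto
  then have "fourier_coeff (distr M (solenoid_borel p) (\<lambda>\<omega> j. \<Prod>k\<in>I. X k \<omega> j)) d l =
      (\<integral>\<omega>. (\<Prod>k\<in>I. X k \<omega> d powi l) \<partial>M)"
    unfolding fourier_coeff_def by (subst integral_distr[OF _ measurable_solenoid_powi]) (simp_all add: prod_power_int)
  also have "\<dots> = (\<Prod>k\<in>I. \<integral>\<omega>. X k \<omega> d powi l \<partial>M)"
  proof (rule indep_vars_lebesgue_integral[OF I])
    show "indep_vars (\<lambda>_. borel) (\<lambda>k \<omega>. X k \<omega> d powi l) I"
      by (rule indep_vars_compose2[OF indep measurable_solenoid_powi])
    show "integrable M (\<lambda>\<omega>. X k \<omega> d powi l)" if k: "k \<in> I" for k
    proof (rule integrable_const_bound[where B = 1])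
      show "AE \<omega> in M. norm (X k \<omega> d powi l) \<le> 1"
        using norm_solenoid_powi[of "X k _" p d l] measurable_space[OF X[OF k]] by (auto intro: eq_refl)
    qed (rule measurable_compose[OF X[OF k] measurable_solenoid_powi])
  qed
  finally show ?thesis .
qed

text \<open>If all arguments up to index \<open>d\<close> are at most
  \<open>pi / (2 * real p)\<close>, then multiplied by \<open>p\<close> they stay below
  \<open>pi\<close>, and \<open>solenoid_coord_eq_exp\<close> makes the two integrands equal. On the
  exceptional event two numbers of norm 1 differ by at most 2.\<close>

lemma solenoid_character_approx:
  assumes X: "X \<in> measurable M (solenoid_borel p)" and p: "p > 0"
  shows "norm ((\<integral>\<omega>. X \<omega> d powi l \<partial>M) - (\<integral>\<omega>. iexp (real_of_int l / real p ^ d * circle_arg (X \<omega> 0)) \<partial>M))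
    \<le> 2 * prob {\<omega> \<in> space M. \<exists>j\<le>d. \<bar>circle_arg (X \<omega> j)\<bar> > pi / (2 * real p)}"
    (is "norm ((\<integral>\<omega>. ?W \<omega> \<partial>M) - (\<integral>\<omega>. ?Z \<omega> \<partial>M)) \<le> 2 * prob ?B")
proof -
  have B: "?B \<in> events"
    by (rule sets_solenoid_circle_arg_large[OF X])
  have norm_W: "norm (?W \<omega>) = 1" if "\<omega> \<in> space M" for \<omega>
    using measurable_space[OF X that] by (intro norm_solenoid_powi) simp
  have W: "integrable M ?W"
    using norm_W by (intro integrable_const_bound[where B = 1] measurable_compose[OF X measurable_solenoid_powi]) auto
  note measurable_solenoid_circle_arg[OF X, measurable]
  have Z: "integrable M ?Z"
    by (intro integrable_const_bound[where B = 1]) auto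
  have "norm ((\<integral>\<omega>. ?W \<omega> \<partial>M) - (\<integral>\<omega>. ?Z \<omega> \<partial>M)) = norm (\<integral>\<omega>. ?W \<omega> - ?Z \<omega> \<partial>M)"
    using W Z by simp
  also have "\<dots> \<le> (\<integral>\<omega>. norm (?W \<omega> - ?Z \<omega>) \<partial>M)"
    by (rule integral_norm_bound)
  also have "\<dots> \<le> (\<integral>\<omega>. 2 * indicator ?B \<omega> \<partial>M)"
  proof (rule integral_mono)
    fix \<omega> assume \<omega>: "\<omega> \<in> space M"
    show "norm (?W \<omega> - ?Z \<omega>) \<le> 2 * indicator ?B \<omega>"
    proof (cases "\<omega> \<in> ?B")
      case True
      have "norm (?W \<omega> - ?Z \<omega>) \<le> norm (?W \<omega>) + norm (?Z \<omega>)"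
        by (rule norm_triangle_ineq4)
      also have "\<dots> = 2"
        unfolding norm_W[OF \<omega>] norm_exp_i_times by simp
      finally show ?thesis
        using True by simp
    next
      case False
      have "X \<omega> d = iexp (circle_arg (X \<omega> 0) / real p ^ d)"
      proof (rule solenoid_coord_eq_exp[OF _ p])
        show "X \<omega> \<in> solenoid p"
          using measurable_space[OF X \<omega>] by simp
        fix j assume "j \<le> d"
        then have "\<bar>circle_arg (X \<omega> j)\<bar> \<le> pi / (2 * real p)"
          using False \<omega> by force
        then have "real p * \<bar>circle_arg (X \<omega> j)\<bar> \<le> pi / 2"
          using p by (simp add: field_simps)
        then show "real p * \<bar>circle_arg (X \<omega> j)\<bar> < pi"
          using pi_gt_zero by linarith
      qed
      then have "?W \<omega> = ?Z \<omega>"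
        by (simp add: exp_power_int mult_ac)
      then show ?thesis
        by simp
    qed
  qed (use W Z B in \<open>auto simp: emeasure_eq_measure\<close>)
  also have "\<dots> = 2 * prob ?B"
    using B by simp
  finally show ?thesis .
qed

end

text \<open>Leaving a neighbourhood of the identity forces a large argument among finitely many
  coordinates, and the maximum over a row is at most the sum. The condition
  \<open>K n \<ge> 1\<close> keeps the maximum over a nonempty set.\<close>

lemma infinitesimal_arrayI:
  assumes prob: "\<And>n. n \<ge> 1 \<Longrightarrow> prob_space (M n)" and K: "\<And>n. n \<ge> 1 \<Longrightarrow> K n \<ge> 1"
    and X: "\<And>n k. n \<ge> 1 \<Longrightarrow> k \<in> {1..K n} \<Longrightarrow> X n k \<in> measurable (M n) (solenoid_borel p)"
    and tail: "\<And>d \<epsilon>. \<epsilon> > 0 \<Longrightarrow>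
           (\<lambda>n. \<Sum>k=1..K n. measure (M n)
              {\<omega> \<in> space (M n). \<exists>j\<le>d. \<bar>circle_arg (X n k \<omega> j)\<bar> > \<epsilon>}) \<longlonglongrightarrow> 0"
  shows "infinitesimal_array p M K X"
  unfolding infinitesimal_array_def
proof (intro ballI impI)
  fix U assume U: "U \<in> sets (solenoid_borel p)"
    and "\<exists>V. openin (top_of_set (solenoid p)) V \<and> (\<lambda>_. 1) \<in> V \<and> V \<subseteq> U"
  then obtain V where V: "openin (top_of_set (solenoid p)) V" "(\<lambda>_. 1) \<in> V" "V \<subseteq> U"
    by blast
  obtain d \<epsilon> where \<epsilon>: "\<epsilon> > 0"
    "\<And>y. y \<in> solenoid p \<Longrightarrow> (\<And>j. j \<le> d \<Longrightarrow> \<bar>circle_arg (y j)\<bar> \<le> \<epsilon>) \<Longrightarrow> y \<in> V"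
    using solenoid_nbhd_identity[OF V(1,2)] by blast
  let ?Q = "\<lambda>n k. measure (M n) {\<omega> \<in> space (M n). X n k \<omega> \<in> solenoid p - U}"
  let ?P = "\<lambda>n k. measure (M n) {\<omega> \<in> space (M n). \<exists>j\<le>d. \<bar>circle_arg (X n k \<omega> j)\<bar> > \<epsilon>}"
  have bounds: "0 \<le> (MAX k\<in>{1..K n}. ?Q n k)" "(MAX k\<in>{1..K n}. ?Q n k) \<le> (\<Sum>k=1..K n. ?P n k)"
    if n: "n \<ge> 1" for n
  proof -
    interpret prob_space "M n" by (rule prob[OF n])
    have ne: "{1..K n} \<noteq> {}"
      using K[OF n] by simp
    have "?Q n k \<le> (\<Sum>k=1..K n. ?P n k)" if k: "k \<in> {1..K n}" for k
    proof -
      have "?Q n k \<le> ?P n k"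
      proof (rule finite_measure_mono)
        show "{\<omega> \<in> space (M n). X n k \<omega> \<in> solenoid p - U} \<subseteq>
          {\<omega> \<in> space (M n). \<exists>j\<le>d. \<bar>circle_arg (X n k \<omega> j)\<bar> > \<epsilon>}"
          using \<epsilon>(2) V(3) by (force simp: not_le[symmetric])
      qed (rule sets_solenoid_circle_arg_large[OF X[OF n k]])
      also have "\<dots> \<le> (\<Sum>k=1..K n. ?P n k)"
        by (rule member_le_sum[OF k]) auto
      finally show ?thesis .
    qed
    then show "(MAX k\<in>{1..K n}. ?Q n k) \<le> (\<Sum>k=1..K n. ?P n k)"
      using ne by (intro Max.boundedI) auto
    have "0 \<le> ?Q n 1" by simp
    also have "\<dots> \<le> (MAX k\<in>{1..K n}. ?Q n k)"
      using K[OF n] by (intro Max_ge) auto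
    finally show "0 \<le> (MAX k\<in>{1..K n}. ?Q n k)" .
  qed
  show "(\<lambda>n. MAX k\<in>{1..K n}. ?Q n k) \<longlonglongrightarrow> 0"
    by (rule tendsto_sandwich[OF _ _ tendsto_const tail[OF \<epsilon>(1), of d]];
        rule eventually_sequentiallyI[of 1]; rule bounds)
qed

theorem theorem8p2:
  fixes p :: nat
    and M :: "nat \<Rightarrow> 'a measure"
    and K :: "nat \<Rightarrow> nat"
    and X :: "nat \<Rightarrow> nat \<Rightarrow> 'a \<Rightarrow> nat \<Rightarrow> complex"
    and a :: "nat \<Rightarrow> complex"
    and b :: real
  assumes "prime p"
    and "\<And>n. n \<ge> 1 \<Longrightarrow> prob_space (M n)"
    and "\<And>n. n \<ge> 1 \<Longrightarrow> K n \<ge> 1"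
    and "rowwise_independent_array p M K X"
    and "a \<in> solenoid p"
    and "b \<ge> 0"
    and "\<And>d. (\<lambda>n. exp (\<i> / of_nat p ^ d *
              of_real (\<Sum>k=1..K n. prob_space.expectation (M n) (\<lambda>\<omega>. circle_arg (X n k \<omega> 0)))))
            \<longlonglongrightarrow> a d"
    and "(\<lambda>n. \<Sum>k=1..K n. prob_space.variance (M n) (\<lambda>\<omega>. circle_arg (X n k \<omega> 0))) \<longlonglongrightarrow> b"
    and "\<And>d \<epsilon>. \<epsilon> > 0 \<Longrightarrow>
           (\<lambda>n. \<Sum>k=1..K n. measure (M n)
              {\<omega> \<in> space (M n). \<exists>j\<le>d. \<bar>circle_arg (X n k \<omega> j)\<bar> > \<epsilon>}) \<longlonglongrightarrow> 0"
  shows "infinitesimal_array p M K X \<and>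
         solenoid_weak_conv p
           (\<lambda>n. distr (M n) (solenoid_borel p) (\<lambda>\<omega> j. \<Prod>k=1..K n. X n k \<omega> j))
           (solenoid_convolution p (return (solenoid_borel p) a) (solenoid_gauss p b))"
proof
  note prob = assms(2) and K = assms(3) and a = assms(5) and b = assms(6)
    and mean = assms(7) and var = assms(8) and tail = assms(9)
  have p: "p > 0"
    using assms(1) by (rule prime_gt_0_nat)
  have X: "X n k \<in> measurable (M n) (solenoid_borel p)" if "n \<ge> 1" "k \<in> {1..K n}" for n k
    using assms(4) that by (simp add: rowwise_independent_array_def)
  have indep: "prob_space.indep_vars (M n) (\<lambda>_. solenoid_borel p) (X n) {1..K n}" if "n \<ge> 1" for n
    using assms(4) that by (simp add: rowwise_independent_array_def)
  show "infinitesimal_array p M K X"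
    by (rule infinitesimal_arrayI[OF prob K X tail])

  define \<mu> where "\<mu> n = distr (M n) (solenoid_borel p) (\<lambda>\<omega> j. \<Prod>k=1..K n. X n k \<omega> j)" for n
  define \<nu> where "\<nu> = solenoid_convolution p (return (solenoid_borel p) a) (solenoid_gauss p b)"
  have return: "prob_space (return (solenoid_borel p) a)"
    using a by (intro prob_space_return) simp
  have \<nu>: "prob_space \<nu>" "sets \<nu> = sets (solenoid_borel p)"
    unfolding \<nu>_def using p b
    by (auto intro!: prob_space_solenoid_convolution return prob_space_solenoid_gauss simp: sets_solenoid_gauss)
  have \<mu>: "prob_space (\<mu> n)" if n: "n \<ge> 1" for n
  proof -
    interpret prob_space "M n" by (rule prob[OF n])
    show ?thesis
      unfolding \<mu>_def using measurable_space[OF X[OF n]]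
      by (intro prob_space_distr measurable_solenoid_borelI borel_measurable_prod
          measurable_compose[OF X[OF n] measurable_solenoid_coord] solenoid_prod) auto
  qed
  \<comment> \<open>Rows are constrained only from index 1 on, while
    \<open>solenoid_weak_convI\<close> and \<open>prod_char_bounded_array_tendsto\<close> want a
    probability space for every index; hence the shift by \<open>Suc\<close>, undone at the
    end.\<close>
  have "(\<lambda>n. fourier_coeff (\<mu> (Suc n)) d l) \<longlonglongrightarrow> fourier_coeff \<nu> d l" for d l
  proof -
    define t where "t = real_of_int l / real p ^ d"
    define \<theta> where "\<theta> n k \<omega> = circle_arg (X n k \<omega> 0)" for n k \<omega>
    define Z where "Z n = (\<Prod>k=1..K n. \<integral>\<omega>. iexp (t * \<theta> n k \<omega>) \<partial>M n)" for n
    define c where "c n = iexp (t * (\<Sum>k=1..K n. prob_space.expectation (M n) (\<theta> n k)))" for n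
    let ?B = "\<lambda>n k. {\<omega> \<in> space (M n). \<exists>j\<le>d. \<bar>circle_arg (X n k \<omega> j)\<bar> > pi / (2 * real p)}"
    have 1: "(\<lambda>n. fourier_coeff (\<mu> (Suc n)) d l - Z (Suc n)) \<longlonglongrightarrow> 0"
    proof (rule Lim_null_comparison)
      have "norm (fourier_coeff (\<mu> n) d l - Z n) \<le> 2 * (\<Sum>k=1..K n. measure (M n) (?B n k))"
        if n: "n \<ge> 1" for n
      proof -
        interpret prob_space "M n" by (rule prob[OF n])
        have "norm (fourier_coeff (\<mu> n) d l - Z n) \<le>
          (\<Sum>k=1..K n. norm ((\<integral>\<omega>. X n k \<omega> d powi l \<partial>M n) - (\<integral>\<omega>. iexp (t * \<theta> n k \<omega>) \<partial>M n)))"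
          unfolding \<mu>_def Z_def fourier_coeff_distr_prod[OF finite_atLeastAtMost indep[OF n]]
        proof (rule norm_prod_diff)
          show "norm (\<integral>\<omega>. X n k \<omega> d powi l \<partial>M n) \<le> 1" if k: "k \<in> {1..K n}" for k
          proof -
            have "norm (\<integral>\<omega>. X n k \<omega> d powi l \<partial>M n) \<le> (\<integral>\<omega>. norm (X n k \<omega> d powi l) \<partial>M n)"
              by (rule integral_norm_bound)
            also have "\<dots> = (\<integral>\<omega>. 1 \<partial>M n)"
              using measurable_space[OF X[OF n k]]
              by (intro Bochner_Integration.integral_cong norm_solenoid_powi) auto
            finally show ?thesis
              by (simp add: prob_space)
          qed
          show "norm (\<integral>\<omega>. iexp (t * \<theta> n k \<omega>) \<partial>M n) \<le> 1" for k
            using integral_norm_bound[of "M n" "\<lambda>\<omega>. iexp (t * \<theta> n k \<omega>)"] by (simp add: prob_space)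
        qed
        also have "\<dots> \<le> (\<Sum>k=1..K n. 2 * measure (M n) (?B n k))"
          unfolding t_def \<theta>_def by (intro sum_mono solenoid_character_approx X[OF n] p)
        finally show ?thesis
          by (simp add: sum_distrib_left)
      qed
      then show "\<forall>\<^sub>F n in sequentially. norm (fourier_coeff (\<mu> (Suc n)) d l - Z (Suc n)) \<le>
          2 * (\<Sum>k=1..K (Suc n). measure (M (Suc n)) (?B (Suc n) k))"
        by (intro always_eventually allI) simp
      have "(\<lambda>n. 2 * (\<Sum>k=1..K n. measure (M n) (?B n k))) \<longlonglongrightarrow> 2 * 0"
        using p by (intro tendsto_intros tail) simp
      then show "(\<lambda>n. 2 * (\<Sum>k=1..K (Suc n). measure (M (Suc n)) (?B (Suc n) k))) \<longlonglongrightarrow> 0"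
        unfolding mult_zero_right by (rule LIMSEQ_Suc)
    qed
    have 2: "(\<lambda>n. Z (Suc n) - c (Suc n) * exp (- (t\<^sup>2 * b / 2))) \<longlonglongrightarrow> 0"
      unfolding Z_def c_def
    proof (rule prod_char_bounded_array_tendsto[where C = pi])
      show "prob_space (M (Suc n))" for n
        by (simp add: prob)
      show "\<theta> (Suc n) k \<in> borel_measurable (M (Suc n))" if "k \<in> {1..K (Suc n)}" for n k
        unfolding \<theta>_def[abs_def] by (rule measurable_solenoid_circle_arg[OF X[OF _ that]]) simp
      show "\<bar>\<theta> (Suc n) k \<omega>\<bar> \<le> pi" if "k \<in> {1..K (Suc n)}" "\<omega> \<in> space (M (Suc n))" for n k \<omega>
        unfolding \<theta>_def using measurable_space[OF X[OF _ that(1)] that(2)]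
        by (intro abs_circle_arg_le norm_solenoid[of _ p]) auto
      show "(\<lambda>n. \<Sum>k=1..K (Suc n). prob_space.variance (M (Suc n)) (\<theta> (Suc n) k)) \<longlonglongrightarrow> b"
        using LIMSEQ_Suc[OF var] by (simp add: \<theta>_def[abs_def])
      \<comment> \<open>The real array sees only coordinate 0, so this is the tail condition for
        \<open>d = 0\<close>.\<close>
      show "(\<lambda>n. \<Sum>k=1..K (Suc n). measure (M (Suc n)) {\<omega> \<in> space (M (Suc n)). \<bar>\<theta> (Suc n) k \<omega>\<bar> > \<epsilon>}) \<longlonglongrightarrow> 0"
        if "\<epsilon> > 0" for \<epsilon>
        using LIMSEQ_Suc[OF tail[OF that, of 0]] by (simp add: \<theta>_def)
    qed simp
    \<comment> \<open>Since \<open>t = l / p ^ d\<close>, the centring factor is the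
      \<open>l\<close>-th power of the sequence in the hypothesis on the means; \<open>a d\<close>
      is nonzero, so negative \<open>l\<close> are covered too.\<close>
    have 3: "(\<lambda>n. c (Suc n)) \<longlonglongrightarrow> a d powi l"
    proof -
      have "(\<lambda>n. exp (\<i> / of_nat p ^ d *
              of_real (\<Sum>k=1..K n. prob_space.expectation (M n) (\<lambda>\<omega>. circle_arg (X n k \<omega> 0)))) powi l)
            \<longlonglongrightarrow> a d powi l"
        by (rule tendsto_power_int[OF mean solenoid_nonzero[OF a]])
      also have "(\<lambda>n. exp (\<i> / of_nat p ^ d *
              of_real (\<Sum>k=1..K n. prob_space.expectation (M n) (\<lambda>\<omega>. circle_arg (X n k \<omega> 0)))) powi l) = c"
        unfolding c_def \<theta>_def[abs_def] t_def by (auto simp: exp_power_int mult_ac)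
      finally show ?thesis
        by (rule LIMSEQ_Suc)
    qed
    have "(\<lambda>n. (fourier_coeff (\<mu> (Suc n)) d l - Z (Suc n)) + (Z (Suc n) - c (Suc n) * exp (- (t\<^sup>2 * b / 2)))
        + c (Suc n) * exp (- (t\<^sup>2 * b / 2))) \<longlonglongrightarrow> 0 + 0 + a d powi l * exp (- (t\<^sup>2 * b / 2))"
      by (intro tendsto_add 1 2 tendsto_mult 3 tendsto_const)
    then have "(\<lambda>n. fourier_coeff (\<mu> (Suc n)) d l) \<longlonglongrightarrow> a d powi l * exp (- (t\<^sup>2 * b / 2))"
      by simp
    moreover have "fourier_coeff \<nu> d l = a d powi l * exp (- (t\<^sup>2 * b / 2))"
      unfolding \<nu>_def using p b return
      by (simp add: fourier_coeff_solenoid_convolution prob_space_solenoid_gauss sets_solenoid_gauss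
          fourier_coeff_return[OF a] fourier_coeff_solenoid_gauss t_def power_divide power_mult[symmetric] mult_ac)
    ultimately show ?thesis
      by simp
  qed
  then have "solenoid_weak_conv p (\<lambda>n. \<mu> (Suc n)) \<nu>"
    by (intro solenoid_weak_convI) (simp_all add: \<mu> \<nu>, simp add: \<mu>_def)
  then show "solenoid_weak_conv p (\<lambda>n. distr (M n) (solenoid_borel p) (\<lambda>\<omega> j. \<Prod>k=1..K n. X n k \<omega> j))
     (solenoid_convolution p (return (solenoid_borel p) a) (solenoid_gauss p b))"
    unfolding solenoid_weak_conv_def \<mu>_def[symmetric] \<nu>_def[symmetric] by (blast intro: LIMSEQ_imp_Suc)
qed

end
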